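(* Let $L\subset L_m$ be a partial staircase. With respect to a certain term order, the monomial basis constructed from $\mathbf m^{(nc)}_L$ is the basis of standard monomials. That is, let $S=\mathbb C[y_I: I\in 2^{\mathbf m}_L]$ be a polynomial ring, let $\phi:S\to\mathbb C[x_{ij}:1\le i,j\le m]$ be the $\mathbb C$-algebra homomorphism with $\phi(y_I)=x_I$, and let $K=\ker\phi$. Then there is a term order on $S$ such that the standard monomials, i.e. the monomials of $S$ not lying in the initial ideal $\mathrm{in}(K)$, are exactly the monomials $\prod_{I\in T} y_I$ where $T$ runs over all finite multisets of elements of $2^{\mathbf m}_L$ whose set of distinct elements is a face of $\mathbf m^{(nc)}_L$.
   Context: Shapes. Let $m\ge1$, $[m]=\{1,\dots,m\}$. The source is $(0,0)$; the sinks of the staircase $L_m$ are the points $(m-k,k)$, $0\le k\le m$. A partial staircase $L\subset L_m$ is given by a nonempty set of selected sinks (the sinks of $L$) together with all nodes of $\mathbb Z_{\ge 0}^2$ weakly south and west of some selected sink. For $I\subseteq[m]$, $p(I)$ is the lattice path from $(0,0)$ of length $m$ whose $t$-th step is north if $t\in I$ and east otherwise. $2^{\mathbf m}_L$ is the set of $I\subseteq[m]$ such that $p(I)$ is contained in $L$ (equivalently, $(m-|I|,|I|)$ is a sink of $L$). Minors. $X=(x_{ij})$ is an $m\times m$ matrix of indeterminates (rows numbered from the bottom), and $x_I$ is the minor of $X$ with column set $I$ and row set $\{1,\dots,|I|\}$. The Plücker algebra is generated by the $x_I$; for a partial staircase $L$ one takes the subalgebra generated by the $x_I$ with $I\in 2^{\mathbf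 m}_L$. The monomial basis constructed from $\mathbf m^{(nc)}_L$ consists of the products $\prod_{I\in T}x_I$ over finite multisets $T$ whose set of distinct elements is a face of $\mathbf m^{(nc)}_L$. Non-crossing rule. Two pairs $\{u<v\}$, $\{x<y\}$ of elements of $\mathbb Z\cup\{\infty\}$ are non-crossing if neither $x<u<y<v$ nor $u<x<v<y$ holds. Let $I=\{i_1<\dots<i_k\}$, $J=\{j_1<\dots<j_l\}$ be subsets of $[m]$ with $k\le l$. For every $s$ with $i_s=j_s$ remove $i_s$ from $I$ and $j_s$ from $J$, obtaining $I'=\{i'_1<\dots<i'_{k'}\}$ and $J'=\{j'_1<\dots<j'_{l'}\}$. $I$ and $J$ are non-crossing if (1) for all $1\le s\le k'-1$ the pairs $\{i'_s,i'_{s+1}\}$, $\{j'_s,j'_{s+1}\}$ are non-crossing, and (2) if $k'<l'$, the pairs $\{i'_{k'},\infty\}$, $\{j'_{k'},j'_{k'+1}\}$ are non-crossing (vacuous if $k'=0$). $\mathbf m^{(nc)}_L$ is the simplicial complex on vertex set $2^{\mathbf m}_L$ whose faces are the sets of pairwise non-crossing elements.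
   Formalization: The variable y_∅ is left out of S and T ranges over multisets of nonempty I: if the sink (m,0) is selected, x_∅ = 1 puts y_∅ − 1 in K, so y_∅ lies in in(K) for every term order although {∅} is a face. *)

theory Defs
  imports
    "Jordan_Normal_Form.Determinant"
    "HOL-Algebra.Ideal"
    "HOL-Algebra.RingHom"
    "HOL-Library.Poly_Mapping"
    "HOL-Library.Multiset"
    "HOL-Library.Extended_Nat"
begin

section \<open>Partial staircases\<close>

text \<open>A shape is represented by its set of nodes. The selected sinks are recovered as
  \<open>L \<inter> sinks m\<close>, because no sink of the staircase is weakly south-west of another one.\<close>

definition sinks :: "nat \<Rightarrow> (nat \<times> nat) set" where
  "sinks m = {(m - k, k) |k. k \<le> m}"

definition partial_staircase :: "nat \<Rightarrow> (nat \<times> nat) set \<Rightarrow> bool" where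
  "partial_staircase m L \<longleftrightarrow>
     (\<exists>D. D \<subseteq> sinks m \<and> D \<noteq> {} \<and> L = {(a, b). \<exists>(c, d)\<in>D. a \<le> c \<and> b \<le> d})"

text \<open>After \<open>t\<close> steps the path \<open>p(I)\<close> has made one north step for each element of
  \<open>{1..t} \<inter> I\<close> and one east step for each element of \<open>{1..t} - I\<close>.\<close>

definition path_nodes :: "nat \<Rightarrow> nat set \<Rightarrow> (nat \<times> nat) set" where
  "path_nodes m I = {(card ({1..t} - I), card ({1..t} \<inter> I)) |t. t \<le> m}"

definition staircase_subsets :: "nat \<Rightarrow> (nat \<times> nat) set \<Rightarrow> nat set set" where
  "staircase_subsets m L = {I. I \<subseteq> {1..m} \<and> path_nodes m I \<subseteq> L}"


section \<open>The non-crossing complex\<close>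

text \<open>Pairs \<open>{u < v}\<close> are given in increasing order; type \<open>enat\<close> supplies \<open>\<infinity>\<close>.\<close>

definition noncrossing_pairs :: "enat \<times> enat \<Rightarrow> enat \<times> enat \<Rightarrow> bool" where
  "noncrossing_pairs = (\<lambda>(u, v) (x, y). \<not> (x < u \<and> u < y \<and> y < v) \<and> \<not> (u < x \<and> x < v \<and> v < y))"

definition common_positions :: "nat set \<Rightarrow> nat set \<Rightarrow> nat set" where
  "common_positions I J =
     {sorted_list_of_set I ! s |s. s < card I \<and> s < card J \<and>
        sorted_list_of_set I ! s = sorted_list_of_set J ! s}"

text \<open>The rule for \<open>card I \<le> card J\<close>. List indices start at \<open>0\<close>, so \<open>is ! (length is - 1)\<close>
  and \<open>js ! (length is - 1)\<close> are the entries in position \<open>k'\<close>.\<close>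

definition noncrossing_le :: "nat set \<Rightarrow> nat set \<Rightarrow> bool" where
  "noncrossing_le I J \<longleftrightarrow>
     (let is = sorted_list_of_set (I - common_positions I J);
          js = sorted_list_of_set (J - common_positions I J)
      in (\<forall>s. Suc s < length is \<longrightarrow>
            noncrossing_pairs (enat (is ! s), enat (is ! Suc s)) (enat (js ! s), enat (js ! Suc s))) \<and>
         (0 < length is \<and> length is < length js \<longrightarrow>
            noncrossing_pairs (enat (is ! (length is - 1)), \<infinity>)
              (enat (js ! (length is - 1)), enat (js ! length is))))"

definition noncrossing :: "nat set \<Rightarrow> nat set \<Rightarrow> bool" where
  "noncrossing I J \<longleftrightarrow> (if card I \<le> card J then noncrossing_le I J else noncrossing_le J I)"

definition noncrossing_complex :: "nat \<Rightarrow> (nat \<times> nat) set \<Rightarrow> nat set set set" where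
  "noncrossing_complex m L = {F. F \<subseteq> staircase_subsets m L \<and> pairwise noncrossing F}"


section \<open>Polynomial rings over the complex numbers\<close>

text \<open>A monomial is its exponent function, a polynomial is a finitely supported coefficient function
  on monomials; multiplication of monomials is addition of exponents.\<close>

type_synonym 'v monom = "'v \<Rightarrow>\<^sub>0 nat"
type_synonym 'v cpoly = "'v monom \<Rightarrow>\<^sub>0 complex"

definition monomials :: "'v set \<Rightarrow> 'v monom set" where
  "monomials V = {t. Poly_Mapping.keys t \<subseteq> V}"

definition cpoly_ring :: "'v set \<Rightarrow> 'v cpoly ring" where
  "cpoly_ring V = \<lparr>carrier = {p. Poly_Mapping.keys p \<subseteq> monomials V},
     mult = (*), one = 1, zero = 0, add = (+)\<rparr>"

definition const :: "complex \<Rightarrow> 'v cpoly" where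
  "const c = Poly_Mapping.single 0 c"

definition mono_poly :: "'v monom \<Rightarrow> 'v cpoly" where
  "mono_poly t = Poly_Mapping.single t 1"

definition var :: "'v \<Rightarrow> 'v cpoly" where
  "var v = mono_poly (Poly_Mapping.single v 1)"

definition subst_poly :: "('v \<Rightarrow> 'w cpoly) \<Rightarrow> 'v cpoly \<Rightarrow> 'w cpoly" where
  "subst_poly f p = (\<Sum>t\<in>Poly_Mapping.keys p. const (Poly_Mapping.lookup p t) *
     (\<Prod>v\<in>Poly_Mapping.keys t. f v ^ Poly_Mapping.lookup t v))"


section \<open>Term orders and initial ideals\<close>

text \<open>\<open>(s, t) \<in> r\<close> means that \<open>s\<close> is smaller than or equal to \<open>t\<close>.\<close>

definition term_order :: "'v set \<Rightarrow> 'v monom rel \<Rightarrow> bool" where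
  "term_order V r \<longleftrightarrow> linear_order_on (monomials V) r \<and>
     (\<forall>t\<in>monomials V. (0, t) \<in> r) \<and>
     (\<forall>s t u. (s, t) \<in> r \<and> u \<in> monomials V \<longrightarrow> (s + u, t + u) \<in> r)"

definition leading_monom :: "'v monom rel \<Rightarrow> 'v cpoly \<Rightarrow> 'v monom" where
  "leading_monom r p =
     (THE t. t \<in> Poly_Mapping.keys p \<and> (\<forall>s\<in>Poly_Mapping.keys p. (s, t) \<in> r))"

definition initial_ideal :: "'v set \<Rightarrow> 'v monom rel \<Rightarrow> 'v cpoly set \<Rightarrow> 'v cpoly set" where
  "initial_ideal V r K =
     genideal (cpoly_ring V) {mono_poly (leading_monom r p) |p. p \<in> K \<and> p \<noteq> 0}"

definition standard_monomials :: "'v set \<Rightarrow> 'v monom rel \<Rightarrow> 'v cpoly set \<Rightarrow> 'v cpoly set" where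
  "standard_monomials V r K =
     {mono_poly t |t. t \<in> monomials V \<and> mono_poly t \<notin> initial_ideal V r K}"


section \<open>Minors of a matrix of indeterminates\<close>

text \<open>Rows and columns of the indeterminates \<open>x\<^sub>i\<^sub>j\<close> are numbered from \<open>1\<close>, whereas matrix and list
  indices start at \<open>0\<close>. Numbering the rows from the bottom only affects how the matrix is
  drawn: \<open>x\<^sub>I\<close> has row set \<open>{1..card I}\<close>, taken in increasing order.\<close>

definition minor :: "nat set \<Rightarrow> (nat \<times> nat) cpoly" where
  "minor I = det (mat (card I) (card I) (\<lambda>(r, c). var (Suc r, sorted_list_of_set I ! c)))"

definition minor_relations :: "nat \<Rightarrow> nat set set \<Rightarrow> nat set cpoly set" where
  "minor_relations m V =
     a_kernel (cpoly_ring V) (cpoly_ring ({1..m} \<times> {1..m})) (subst_poly minor)"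

text \<open>The index set used for the polynomial ring in the theorem is
  \<open>staircase_subsets m L - {{}}\<close>. The empty set belongs to \<open>staircase_subsets m L\<close> exactly when
  \<open>(m, 0)\<close> is a selected sink. Its minor is the constant \<open>1\<close>, so it contributes
  nothing to the algebra, and a variable for it would be congruent to \<open>1\<close> modulo the kernel and
  hence never a standard monomial. The empty set is non-crossing with every set, so
  leaving it out removes a cone point of the complex.\<close>

lemma minor_empty: "minor {} = 1"
  by (simp add: minor_def det_def)

lemma noncrossing_empty: "noncrossing {} J" "noncrossing J {}"
  by (auto simp: noncrossing_def noncrossing_le_def Let_def common_positions_def)

end

theory Submission
  imports Defs "HOL-Library.Product_Lexorder" "HOL-Library.List_Lexorder"
begin

text \<open>A product of minors is compared with others through its diagonal term, which for a suitable
  lexicographic order is its leading monomial; it records, for every row, the multiset of the entries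
  which the columns have in that row. Each such family of row multisets is realised by at most one
  multiset of columns that is a chain for componentwise comparison and by at most one non-crossing
  multiset. By Garnir's relations the products along chains span the algebra, so its leading
  monomials are exactly the diagonal terms. On the other hand, exchanging the tails of two crossing
  columns preserves the rows and lowers the correlations \<open>\<Sum>p. f p * f (p + d)\<close> lexicographically,
  so every family of row multisets that occurs is also realised by a non-crossing multiset. Hence the
  non-crossing products are a basis as well, and for the order that compares diagonal terms first and
  correlations second, every crossing monomial is the leading monomial of a relation and no
  non-crossing monomial is.\<close>

section \<open>Columns as increasing sequences\<close>

text \<open>Garnir's relations keep the sizes of the two columns and a tail exchange swaps them, so
  neither leaves the family. The chains serve to exclude that cancellation in the algebra creates a
  leading monomial which is not a diagonal term; after that the non-crossing products only have to
  realise every diagonal term once. Diagonal terms alone do not separate monomials with equal rows,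
  and the tie-break has to make the non-crossing one the smallest. Correlations achieve this by
  rearrangement: if \<open>f s < g s\<close> and \<open>f s' < g s'\<close>, exchanging the tails
  lowers the contribution of the pair \<open>s\<close>, \<open>s'\<close>, while pairs at smaller
  distance keep theirs because the columns agree strictly between \<open>s\<close> and
  \<open>s'\<close>. Pairs at larger distance are not controlled, hence the lexicographic comparison
  by distance. The empty column leaves no trace in a diagonal term; its exclusion lets the diagonal
  term determine the number of columns.\<close>

text \<open>Beyond its last element a column is continued by the values \<open>m + 1 + s\<close>, which play the role of
  \<open>\<infinity>\<close>: the sequence stays strictly increasing, and two columns that are both exhausted agree.\<close>

definition entry :: "nat \<Rightarrow> nat set \<Rightarrow> nat \<Rightarrow> nat" where
  "entry m I s = (if s < card I then sorted_list_of_set I ! s else m + 1 + s)"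

text \<open>These are exactly the sequences \<open>entry m I\<close> for subsets of
  \<open>{1..m}\<close> (\<open>column_seq_entry\<close>, \<open>entry_column_set\<close>).
  Described by their values they can be cut and glued without mention of the underlying sets;
  \<open>column_set\<close> leads back.\<close>

definition column_seq :: "nat \<Rightarrow> (nat \<Rightarrow> nat) \<Rightarrow> bool" where
  "column_seq m h \<longleftrightarrow> strict_mono h \<and> 1 \<le> h 0 \<and> (\<forall>s. h s \<le> m \<or> h s = m + 1 + s)"

definition column_set :: "nat \<Rightarrow> (nat \<Rightarrow> nat) \<Rightarrow> nat set" where
  "column_set m h = {x \<in> range h. x \<le> m}"

lemma entry_in: "finite I \<Longrightarrow> s < card I \<Longrightarrow> entry m I s \<in> I"
  unfolding entry_def by (metis length_sorted_list_of_set nth_mem set_sorted_list_of_set)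

lemma entry_le_iff:
  assumes "I \<subseteq> {1..m}"
  shows "entry m I s \<le> m \<longleftrightarrow> s < card I"
proof -
  have "finite I" using assms finite_subset by blast
  then show ?thesis using entry_in[of I s m] assms by (auto simp: entry_def)
qed

lemma entry_pad: "card I \<le> s \<Longrightarrow> entry m I s = m + 1 + s"
  by (simp add: entry_def)

lemma entry_image:
  assumes "finite I" shows "entry m I ` {..<card I} = I"
proof -
  have "entry m I ` {..<card I} = set (sorted_list_of_set I)"
    unfolding set_conv_nth by (auto simp: entry_def image_iff)
  then show ?thesis using assms by simp
qed

lemma column_seq_entry:
  assumes "I \<subseteq> {1..m}" shows "column_seq m (entry m I)"
proof -
  have fin: "finite I" using assms finite_subset by blast
  have "entry m I s < entry m I (Suc s)" for s
  proof (cases "Suc s < card I")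
    case True
    then show ?thesis
      using sorted_wrt_nth_less[OF strict_sorted_list_of_set[of I], of s "Suc s"]
      by (simp add: entry_def)
  next
    case False
    then show ?thesis
      using entry_le_iff[OF assms, of s] entry_pad[of I "Suc s" m] entry_pad[of I s m]
      by (cases "s < card I") auto
  qed
  then have "strict_mono (entry m I)" by (simp add: strict_mono_Suc_iff)
  moreover have "1 \<le> entry m I 0"
    using entry_in[OF fin, of 0 m] assms by (cases "0 < card I") (auto simp: entry_pad)
  moreover have "entry m I s \<le> m \<or> entry m I s = m + 1 + s" for s
    using entry_le_iff[OF assms] entry_pad[of I s m] by (cases "s < card I") auto
  ultimately show ?thesis by (simp add: column_seq_def)
qed

lemma column_set_entry:
  assumes "I \<subseteq> {1..m}" shows "column_set m (entry m I) = I"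
proof -
  have "finite I" using assms finite_subset by blast
  then have "I = entry m I ` {..<card I}" by (simp add: entry_image)
  also have "\<dots> = column_set m (entry m I)"
    using entry_le_iff[OF assms] by (auto simp: column_set_def)
  finally show ?thesis by simp
qed

lemma inj_on_entry: "inj_on (entry m) (Pow {1..m})"
  by (rule inj_on_inverseI[where g = "column_set m"]) (simp add: column_set_entry)

lemma sorted_list_of_set_image:
  assumes "sorted_wrt (<) (xs :: nat list)" and "strict_mono (h :: nat \<Rightarrow> nat)"
  shows "sorted_list_of_set (h ` set xs) = map h xs"
proof -
  have *: "sorted_wrt (<) (map h xs)"
    unfolding sorted_wrt_map
    by (rule sorted_wrt_mono_rel[OF _ assms(1)]) (simp add: assms(2) strict_mono_less)
  then show ?thesis
    using sorted_list_of_set.idem_if_sorted_distinct[of "map h xs"] by (auto simp: strict_sorted_iff)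
qed

lemma column_seq_bounds:
  assumes "column_seq m h"
  shows "\<exists>k. column_set m h = h ` {..<k} \<and> card (column_set m h) = k \<and> (\<forall>s. h s \<le> m \<longleftrightarrow> s < k)"
proof -
  have sm: "strict_mono h" using assms by (simp add: column_seq_def)
  define k where "k = (LEAST s. m < h s)"
  \<comment> \<open>A strictly increasing sequence of naturals satisfies \<open>n \<le> h n\<close>,
    so index \<open>m + 1\<close> already lies in the padding and the least element exists.\<close>
  have "m < h (Suc m)" using strict_mono_imp_increasing[OF sm, of "Suc m"] by simp
  then have k: "m < h k" unfolding k_def by (rule LeastI)
  have iff: "h s \<le> m \<longleftrightarrow> s < k" for s
  proof
    assume "h s \<le> m" then show "s < k" using k sm by (meson leD leI le_less_trans strict_mono_less_eq)
  next
    assume "s < k" then show "h s \<le> m" unfolding k_def using not_less_Least by fastforce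
  qed
  have eq: "column_set m h = h ` {..<k}" using iff by (auto simp: column_set_def)
  have "card (h ` {..<k}) = k" using strict_mono_imp_inj_on[OF sm] by (simp add: card_image inj_on_subset)
  then show ?thesis using eq iff by (intro exI[of _ k]) simp
qed

lemma
  assumes "column_seq m h"
  shows column_set_subset: "column_set m h \<subseteq> {1..m}"
    and entry_column_set: "entry m (column_set m h) = h"
proof -
  have sm: "strict_mono h" using assms by (simp add: column_seq_def)
  obtain k where k: "column_set m h = h ` {..<k}" "card (column_set m h) = k" "\<And>s. h s \<le> m \<longleftrightarrow> s < k"
    using column_seq_bounds[OF assms] by blast
  have "1 \<le> h s" for s
    using assms sm strict_mono_less_eq[OF sm, of 0 s] unfolding column_seq_def by (metis le0 order_trans)
  then show "column_set m h \<subseteq> {1..m}" by (auto simp: column_set_def)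
  have l: "sorted_list_of_set (column_set m h) = map h [0..<k]"
    using sorted_list_of_set_image[OF _ sm, of "[0..<k]"] k(1) by (simp add: atLeast0LessThan)
  show "entry m (column_set m h) = h"
  proof
    fix s
    show "entry m (column_set m h) s = h s"
      using k(2) k(3)[of s] l assms unfolding entry_def column_seq_def by auto
  qed
qed

text \<open>The size of a column is the index at which its padding begins, and this is visible in
  the tail once position \<open>s\<close> carries a genuine element. Hence an exchange of tails also
  exchanges the sizes.\<close>

lemma card_column_set_tail:
  assumes "column_seq m f" "column_seq m g" "\<And>t. s < t \<Longrightarrow> f t = g t" "f s \<le> m" "g s \<le> m"
  shows "card (column_set m f) = card (column_set m g)"
proof -
  obtain k where k: "card (column_set m f) = k" "\<And>s. f s \<le> m \<longleftrightarrow> s < k"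
    using column_seq_bounds[OF assms(1)] by metis
  obtain l where l: "card (column_set m g) = l" "\<And>s. g s \<le> m \<longleftrightarrow> s < l"
    using column_seq_bounds[OF assms(2)] by metis
  have "s < k" "s < l" using assms k l by auto
  then have "k = l" using k(2)[of l] l(2)[of k] k(2)[of k] l(2)[of l] assms(3)[of k] assms(3)[of l]
    by (metis less_irrefl nat_neq_iff)
  then show ?thesis using k l by simp
qed


section \<open>Crossings\<close>

text \<open>An ordered version of crossing, with \<open>f\<close> the smaller column at both ends;
  \<open>noncrossing\<close> is its failure in both orders. The entries that agree strictly between
  \<open>s\<close> and \<open>s'\<close> are those that disappear with the common positions. Padding
  of \<open>g\<close> at \<open>s'\<close> takes the place of infinity.\<close>

definition cross :: "(nat \<Rightarrow> nat) \<Rightarrow> (nat \<Rightarrow> nat) \<Rightarrow> bool" where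
  "cross f g \<longleftrightarrow> (\<exists>s s'. s < s' \<and> (\<forall>t. s < t \<and> t < s' \<longrightarrow> f t = g t) \<and>
     f s < g s \<and> g s < f s' \<and> f s' < g s')"

lemma last_filter_upt:
  assumes "filter Q [0..<k] \<noteq> []"
  defines "a \<equiv> last (filter Q [0..<k])"
  shows "a < k" "Q a" "\<And>t. a < t \<Longrightarrow> t < k \<Longrightarrow> \<not> Q t"
proof -
  have "a \<in> set (filter Q [0..<k])" unfolding a_def using assms(1) by (rule last_in_set)
  then show "a < k" "Q a" by auto
  have mx: "x \<le> a" if "x \<in> set (filter Q [0..<k])" for x
  proof -
    have "sorted (butlast (filter Q [0..<k]) @ [a])"
      unfolding a_def using assms(1) by (simp add: sorted_wrt_filter)
    moreover have "x \<in> set (butlast (filter Q [0..<k]) @ [a])"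
      using that unfolding a_def append_butlast_last_id[OF assms(1)] .
    ultimately show ?thesis by (auto simp: sorted_append)
  qed
  show "\<not> Q t" if "a < t" "t < k" for t using mx[of t] that by auto
qed

text \<open>Neighbours in a filtered list are indices with only discarded ones between them. This
  turns the rule for lists with common positions deleted into one about the original
  positions.\<close>

lemma successively_filter_upt:
  "successively R (filter Q [0..<k]) \<longleftrightarrow>
     (\<forall>a b. a < b \<and> b < k \<and> Q a \<and> Q b \<and> (\<forall>t. a < t \<and> t < b \<longrightarrow> \<not> Q t) \<longrightarrow> R a b)"
proof (induction k)
  case (Suc k)
  have *: "(filter Q [0..<k] = [] \<or> R (last (filter Q [0..<k])) k) \<longleftrightarrow>
    (\<forall>a. a < k \<and> Q a \<and> (\<forall>t. a < t \<and> t < k \<longrightarrow> \<not> Q t) \<longrightarrow> R a k)"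
  proof (cases "filter Q [0..<k] = []")
    case True
    then show ?thesis by (auto simp: filter_empty_conv)
  next
    case False
    note L = last_filter_upt[OF False]
    have "a = last (filter Q [0..<k])" if "a < k" "Q a" "\<forall>t. a < t \<and> t < k \<longrightarrow> \<not> Q t" for a
      using that L by (meson nat_neq_iff)
    then show ?thesis using L False by blast
  qed
  have **: "successively R (filter Q [0..<Suc k]) \<longleftrightarrow> successively R (filter Q [0..<k]) \<and>
      (Q k \<longrightarrow> filter Q [0..<k] = [] \<or> R (last (filter Q [0..<k])) k)"
    by (auto simp: successively_append_iff)
  show ?case unfolding ** * Suc by (auto simp: less_Suc_eq)
qed simp

text \<open>After deletion of the common positions both columns are still indexed by the same list
  \<open>P\<close>, the positions below \<open>card I\<close> where the entries differ; the longer
  column continues with \<open>[k..<l]\<close>. Condition (1) concerns neighbours in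
  \<open>P\<close>, condition (2) the last element of \<open>P\<close> and the first padded position
  \<open>k\<close> of \<open>I\<close>.\<close>

lemma noncrossing_le_iff:
  assumes I: "I \<subseteq> {1..m}" and J: "J \<subseteq> {1..m}" and le: "card I \<le> card J"
  shows "noncrossing_le I J \<longleftrightarrow> \<not> cross (entry m I) (entry m J) \<and> \<not> cross (entry m J) (entry m I)"
proof -
  define k l f g where "k = card I" and "l = card J" and "f = entry m I" and "g = entry m J"
  have fin: "finite I" "finite J" using I J finite_subset by blast+
  have cf: "column_seq m f" and cg: "column_seq m g"
    using I J by (simp_all add: f_def g_def column_seq_entry)
  then have smf: "strict_mono f" and smg: "strict_mono g" by (simp_all add: column_seq_def)
  have kl: "k \<le> l" using le by (simp add: k_def l_def)
  have fle: "f s \<le> m \<longleftrightarrow> s < k" and gle: "g s \<le> m \<longleftrightarrow> s < l" for s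
    using entry_le_iff[OF I] entry_le_iff[OF J] by (simp_all add: f_def g_def k_def l_def)
  have fpad: "k \<le> s \<Longrightarrow> f s = m + 1 + s" and gpad: "l \<le> s \<Longrightarrow> g s = m + 1 + s" for s
    by (simp_all add: f_def g_def k_def l_def entry_pad)
  define Q where "Q = (\<lambda>s. f s \<noteq> g s)"
  define P where "P = filter Q [0..<k]"
  have com: "common_positions I J = {f s |s. s < k \<and> f s = g s}"
    unfolding common_positions_def using kl
    by (auto simp: f_def g_def k_def l_def entry_def; force)
  have If: "I = f ` {..<k}" using entry_image[OF fin(1)] by (simp add: f_def k_def)
  have Jg: "J = g ` {..<l}" using entry_image[OF fin(2)] by (simp add: g_def l_def)
  have injf: "f x = f y \<longleftrightarrow> x = y" and injg: "g x = g y \<longleftrightarrow> x = y" for x y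
    using smf smg by (simp_all add: strict_mono_eq)
  have Ic: "I - common_positions I J = f ` set P"
    unfolding com unfolding If P_def Q_def by (auto simp: injf) (metis injf)
  have com': "common_positions I J = {g s |s. s < k \<and> f s = g s}"
    unfolding com by metis
  have Jc: "J - common_positions I J = g ` set (P @ [k..<l])"
    unfolding com' unfolding Jg P_def Q_def using kl by (auto simp: injg not_le)
  have sP: "sorted_wrt (<) P" unfolding P_def by (simp add: sorted_wrt_filter)
  have sPk: "sorted_wrt (<) (P @ [k..<l])"
    using sP by (auto simp: sorted_wrt_append P_def)
  have lI: "sorted_list_of_set (I - common_positions I J) = map f P"
    unfolding Ic by (rule sorted_list_of_set_image[OF sP smf])
  have lJ: "sorted_list_of_set (J - common_positions I J) = map g (P @ [k..<l])"
    unfolding Jc by (rule sorted_list_of_set_image[OF sPk smg])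
  have 1: "noncrossing_le I J \<longleftrightarrow>
      (\<forall>s. Suc s < length P \<longrightarrow> noncrossing_pairs (enat (f (P!s)), enat (f (P!Suc s))) (enat (g (P!s)), enat (g (P!Suc s)))) \<and>
      (P \<noteq> [] \<and> k < l \<longrightarrow> noncrossing_pairs (enat (f (last P)), \<infinity>) (enat (g (last P)), enat (g k)))"
    unfolding noncrossing_le_def Let_def lI lJ
    by (auto simp: nth_append last_conv_nth)
  define R where "R = (\<lambda>a b. \<not> (g a < f a \<and> f a < g b \<and> g b < f b) \<and> \<not> (f a < g a \<and> g a < f b \<and> f b < g b))"
  have 2: "noncrossing_le I J \<longleftrightarrow> successively R P \<and>
      (P \<noteq> [] \<and> k < l \<longrightarrow> \<not> (g (last P) < f (last P) \<and> f (last P) < g k))"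
    unfolding 1 successively_conv_nth R_def noncrossing_pairs_def by auto
  have 3: "(P \<noteq> [] \<and> k < l \<longrightarrow> \<not> (g (last P) < f (last P) \<and> f (last P) < g k)) \<longleftrightarrow>
     (\<forall>a. a < k \<and> k < l \<and> Q a \<and> (\<forall>t. a < t \<and> t < k \<longrightarrow> \<not> Q t) \<longrightarrow> \<not> (g a < f a \<and> f a < g k))"
  proof (cases "P = []")
    case True
    then show ?thesis by (auto simp: P_def filter_empty_conv)
  next
    case False
    note L = last_filter_upt[OF False[unfolded P_def], folded P_def]
    have "a = last P" if "a < k" "Q a" "\<forall>t. a < t \<and> t < k \<longrightarrow> \<not> Q t" for a
      using that L by (meson nat_neq_iff)
    then show ?thesis using L False by blast
  qed
  \<comment> \<open>A crossing does not reach beyond position \<open>k\<close>. From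
    \<open>l\<close> on the sequences agree. If \<open>k < l\<close>, they differ at
    \<open>k\<close>, so \<open>k\<close> is not strictly between \<open>a\<close> and
    \<open>b\<close>; and if \<open>a\<close> were in the padding of \<open>f\<close>, no genuine
    entry of \<open>g\<close> could exceed \<open>f a\<close>.\<close>
  have loc: "b < k \<or> b = k \<and> k < l \<and> a < k" if "a < b" "\<forall>t. a < t \<and> t < b \<longrightarrow> f t = g t" "f a \<noteq> g a" "f b \<noteq> g b"
     "f a < g b" "g a < f b" "(f a < g a) = (f b < g b)" for a b
  proof (rule ccontr)
    assume *: "\<not> ?thesis"
    then have kb: "k \<le> b" by auto
    have bl: "b < l" using that(4) fpad[OF kb] gpad[of b] by (metis not_le)
    show False
    proof (cases "a < k")
      case True
      then have "b \<noteq> k" using * bl by auto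
      then have "f k = g k" using True kb that(2) by auto
      then show False using gle[of k] fpad[of k] bl kb by auto
    next
      case False
      then show False using fpad[of a] gle[of b] that bl by auto
    qed
  qed
  have "(noncrossing_le I J) \<longleftrightarrow> (\<forall>a b. a < b \<and> b < k \<and> Q a \<and> Q b \<and> (\<forall>t. a < t \<and> t < b \<longrightarrow> \<not> Q t) \<longrightarrow> R a b) \<and>
     (\<forall>a. a < k \<and> k < l \<and> Q a \<and> (\<forall>t. a < t \<and> t < k \<longrightarrow> \<not> Q t) \<longrightarrow> \<not> (g a < f a \<and> f a < g k))"
    unfolding 2 3 unfolding P_def successively_filter_upt ..
  also have "\<dots> \<longleftrightarrow> \<not> cross f g \<and> \<not> cross g f" (is "?L \<longleftrightarrow> ?Rr")
  proof
    assume L: ?L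
    then have L1: "R a b" if "a < b" "b < k" "Q a" "Q b" "\<forall>t. a < t \<and> t < b \<longrightarrow> f t = g t" for a b
      using that unfolding Q_def by blast
    have L2: "\<not> (g a < f a \<and> f a < g k)" if "a < k" "k < l" "Q a" "\<forall>t. a < t \<and> t < k \<longrightarrow> f t = g t" for a
      using that L unfolding Q_def by blast
    show ?Rr
    proof (intro conjI notI)
      assume "cross f g"
      then obtain a b where ab: "a < b" "\<forall>t. a < t \<and> t < b \<longrightarrow> f t = g t" "f a < g a" "g a < f b" "f b < g b"
        unfolding cross_def by blast
      have "b < k \<or> b = k \<and> k < l \<and> a < k" using ab by (intro loc) auto
      then show False
      proof
        assume "b < k"
        then have "R a b" using ab by (intro L1) (auto simp: Q_def)
        then show False using ab by (simp add: R_def)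
      next
        assume "b = k \<and> k < l \<and> a < k"
        then show False using ab(5) fpad[of k] gle[of k] by auto
      qed
    next
      assume "cross g f"
      then obtain a b where ab: "a < b" "\<forall>t. a < t \<and> t < b \<longrightarrow> g t = f t" "g a < f a" "f a < g b" "g b < f b"
        unfolding cross_def by blast
      have "b < k \<or> b = k \<and> k < l \<and> a < k" using ab by (intro loc) auto
      then show False
      proof
        assume "b < k"
        then have "R a b" using ab by (intro L1) (auto simp: Q_def)
        then show False using ab by (simp add: R_def)
      next
        assume "b = k \<and> k < l \<and> a < k"
        moreover from this have "\<not> (g a < f a \<and> f a < g k)" using ab by (intro L2) (auto simp: Q_def)
        ultimately show False using ab by simp
      qed
    qed
  next
    assume Rr: ?Rr
    have "R a b" if "a < b" "\<forall>t. a < t \<and> t < b \<longrightarrow> \<not> Q t" for a b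
    proof -
      have "\<forall>t. a < t \<and> t < b \<longrightarrow> f t = g t" "\<forall>t. a < t \<and> t < b \<longrightarrow> g t = f t"
        using that(2) by (auto simp: Q_def)
      then show ?thesis using Rr that(1) unfolding cross_def R_def by blast
    qed
    moreover have "\<not> (g a < f a \<and> f a < g k)"
      if "a < k" "k < l" "\<forall>t. a < t \<and> t < k \<longrightarrow> \<not> Q t" for a
    proof
      assume "g a < f a \<and> f a < g k"
      moreover have "g k < f k" using that fpad[of k] gle[of k] by auto
      moreover have "\<forall>t. a < t \<and> t < k \<longrightarrow> g t = f t" using that(3) by (auto simp: Q_def)
      ultimately show False using Rr that(1) unfolding cross_def by blast
    qed
    ultimately show ?L by blast
  qed
  finally show ?thesis by (simp add: f_def g_def)
qed

lemma noncrossing_iff: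
  assumes "I \<subseteq> {1..m}" and "J \<subseteq> {1..m}"
  shows "noncrossing I J \<longleftrightarrow> \<not> cross (entry m I) (entry m J) \<and> \<not> cross (entry m J) (entry m I)"
  using noncrossing_le_iff[OF assms] noncrossing_le_iff[OF assms(2,1)] by (auto simp: noncrossing_def)

text \<open>Exchanging the tails of two crossing columns behind their crossing leaves every \<open>lag\<close> below the width of
  the crossing unchanged and lowers the next one.\<close>

definition lag :: "nat \<Rightarrow> nat \<Rightarrow> nat set \<Rightarrow> nat" where
  "lag m d I = (\<Sum>p<m. entry m I p * entry m I (p + d))"

lemma column_seq_swap_tail:
  assumes f: "column_seq m f" and g: "column_seq m g" and "f s < g (Suc s)"
  shows "column_seq m (\<lambda>t. if t \<le> s then f t else g t)"
proof -
  have "strict_mono (\<lambda>t. if t \<le> s then f t else g t)"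
    using assms unfolding column_seq_def strict_mono_Suc_iff by (auto simp: not_less_eq_eq le_Suc_eq)
  then show ?thesis using f g unfolding column_seq_def by auto
qed

text \<open>The rearrangement inequality for two pairs.\<close>

lemma swap_products_less:
  fixes a b c d :: nat
  assumes "a < b" "c < d" shows "a * d + b * c < a * c + b * d"
proof -
  obtain x y where "b = a + Suc x" "d = c + Suc y" using assms less_iff_Suc_add by auto
  then show ?thesis by (simp add: algebra_simps)
qed

lemma uncross:
  assumes I: "I \<subseteq> {1..m}" and J: "J \<subseteq> {1..m}" and c: "cross (entry m I) (entry m J)"
  shows "\<exists>I' J' d. I' \<subseteq> {1..m} \<and> J' \<subseteq> {1..m} \<and> card I' = card J \<and> card J' = card I \<and>
    (\<forall>s. {#entry m I' s, entry m J' s#} = {#entry m I s, entry m J s#}) \<and>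
    d < m \<and> (\<forall>e<d. lag m e I' + lag m e J' = lag m e I + lag m e J) \<and>
    lag m d I' + lag m d J' < lag m d I + lag m d J"
proof -
  define f g where "f = entry m I" and "g = entry m J"
  have cf: "column_seq m f" and cg: "column_seq m g" using I J by (simp_all add: f_def g_def column_seq_entry)
  then have smf: "strict_mono f" and smg: "strict_mono g" by (simp_all add: column_seq_def)
  obtain s s' where s: "s < s'" "\<And>t. s < t \<Longrightarrow> t < s' \<Longrightarrow> f t = g t" "f s < g s" "g s < f s'" "f s' < g s'"
    using c unfolding cross_def f_def g_def by blast
  define f' g' where "f' = (\<lambda>t. if t \<le> s then f t else g t)" and "g' = (\<lambda>t. if t \<le> s then g t else f t)"
  have gs: "g s < g (Suc s)" using smg by (simp add: strict_mono_less)
  \<comment> \<open>Needed for the glued sequence \<open>g'\<close> to increase across the cut. If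
    the crossing is wider than one step, the columns agree at \<open>Suc s\<close> and monotonicity
    of \<open>g\<close> suffices.\<close>
  have "g s < f (Suc s)"
  proof (cases "s' = Suc s")
    case False
    then show ?thesis using s(1) s(2)[of "Suc s"] gs by simp
  qed (use s in simp)
  then have cf': "column_seq m f'" and cg': "column_seq m g'"
    using column_seq_swap_tail[OF cf cg, of s] column_seq_swap_tail[OF cg cf, of s] gs s(3)
    by (simp_all add: f'_def g'_def)
  \<comment> \<open>The largest value possible at position \<open>s'\<close> is the padding, and
    \<open>f s'\<close> stays below \<open>g s'\<close>; so \<open>f\<close> has a genuine element
    there, and then both columns have one at \<open>s\<close>.\<close>
  have "f s' \<le> m \<or> f s' = m + 1 + s'" "g s' \<le> m \<or> g s' = m + 1 + s'"
    using cf cg unfolding column_seq_def by blast+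
  then have "f s' \<le> m" using s(5) by linarith
  then have le: "f s \<le> m" "g s \<le> m" using s(3,4) by linarith+
  have inc: "t < f t" for t
  proof (induction t)
    case 0
    then show ?case using cf by (simp add: column_seq_def)
  next
    case (Suc t)
    then show ?case using smf by (meson Suc_lessI less_trans_Suc strict_mono_Suc_iff)
  qed
  then have s'm: "s' < m" using \<open>f s' \<le> m\<close> by (meson less_le_trans)
  define I' J' where "I' = column_set m f'" and "J' = column_set m g'"
  have eI: "entry m I' = f'" and eJ: "entry m J' = g'"
    using cf' cg' by (simp_all add: I'_def J'_def entry_column_set)
  have sub: "I' \<subseteq> {1..m}" "J' \<subseteq> {1..m}"
    unfolding I'_def J'_def by (rule column_set_subset[OF cf'], rule column_set_subset[OF cg'])
  have "column_set m g = J" "column_set m f = I"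
    using I J by (simp_all add: f_def g_def column_set_entry)
  then have card: "card I' = card J" "card J' = card I"
    using card_column_set_tail[OF cf' cg, of s] card_column_set_tail[OF cg' cf, of s] le
    by (simp_all add: I'_def J'_def f'_def g'_def)
  have rows: "{#f' t, g' t#} = {#f t, g t#}" for t
    by (simp add: f'_def g'_def add_mset_commute)
  define d where "d = s' - s"
  have dm: "d < m" using s'm by (simp add: d_def)
  \<comment> \<open>If both positions are on the same side of the cut, the summands are at most
    traded between the columns. If the cut separates them, the right one lies strictly between
    \<open>s\<close> and \<open>s'\<close>, where the columns agree.\<close>
  have tm: "f' p * f' (p + e) + g' p * g' (p + e) = f p * f (p + e) + g p * g (p + e)"
    if "p + e < s'" for p e
  proof (cases "p \<le> s \<and> s < p + e")
    case True
    then have "f (p + e) = g (p + e)" using s(2) that by simp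
    then show ?thesis using True by (simp add: f'_def g'_def)
  next
    case False
    then show ?thesis by (auto simp: f'_def g'_def)
  qed
  have tm2: "f' p * f' (p + e) + g' p * g' (p + e) = f p * f (p + e) + g p * g (p + e)" if "s < p" for p e
    using that by (simp add: f'_def g'_def)
  have lags: "lag m e I' + lag m e J' = (\<Sum>p<m. f' p * f' (p + e) + g' p * g' (p + e))"
       "lag m e I + lag m e J = (\<Sum>p<m. f p * f (p + e) + g p * g (p + e))" for e
    unfolding lag_def eI eJ by (simp_all add: sum.distrib f_def g_def)
  have "lag m e I' + lag m e J' = lag m e I + lag m e J" if "e < d" for e
    unfolding lags
  proof (rule sum.cong[OF refl])
    fix p show "f' p * f' (p + e) + g' p * g' (p + e) = f p * f (p + e) + g p * g (p + e)"
      using tm[of p e] tm2[of p e] that by (cases "p \<le> s") (auto simp: d_def)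
  qed
  moreover have "lag m d I' + lag m d J' < lag m d I + lag m d J"
    unfolding lags
  proof (rule sum_strict_mono_ex1)
    \<comment> \<open>At lag \<open>d = s' - s\<close> the pair \<open>s\<close>, \<open>s'\<close>
      is the only one whose contribution changes.\<close>
    have less: "f' s * f' (s + d) + g' s * g' (s + d) < f s * f (s + d) + g s * g (s + d)"
      using swap_products_less[OF s(3,5)] s(1) by (simp add: f'_def g'_def d_def)
    show "\<forall>p\<in>{..<m}. f' p * f' (p + d) + g' p * g' (p + d) \<le> f p * f (p + d) + g p * g (p + d)"
    proof
      fix p
      consider "p < s" | "p = s" | "s < p" by linarith
      then show "f' p * f' (p + d) + g' p * g' (p + d) \<le> f p * f (p + d) + g p * g (p + d)"
      proof cases
        case 1 then show ?thesis using tm[of p d] s(1) by (simp add: d_def)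
      next
        case 2 then show ?thesis using less by simp
      next
        case 3 then show ?thesis using tm2 by simp
      qed
    qed
    have "s < m" using s'm s(1) by simp
    then show "\<exists>p\<in>{..<m}. f' p * f' (p + d) + g' p * g' (p + d) < f p * f (p + d) + g p * g (p + d)"
      using less by blast
  qed simp
  ultimately show ?thesis
    using sub card rows dm by (intro exI[of _ I'] exI[of _ J'] exI[of _ d]) (simp add: eI eJ f_def g_def)
qed


section \<open>Multisets of columns are determined by their rows\<close>

definition same_rows :: "nat \<Rightarrow> nat set multiset \<Rightarrow> nat set multiset \<Rightarrow> bool" where
  "same_rows m T T' \<longleftrightarrow> (\<forall>s. image_mset (\<lambda>I. entry m I s) T = image_mset (\<lambda>I. entry m I s) T')"

text \<open>Read a pair as a label with the value assigned to it: labels are served from the largest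
  down, and each takes the smallest value left above its threshold \<open>l\<close>. In the
  application a label is a column cut off after row \<open>s\<close>, its threshold is its last
  entry, and the value is its next entry.\<close>

definition greedy :: "('a::linorder \<Rightarrow> nat) \<Rightarrow> ('a \<times> nat) multiset \<Rightarrow> bool" where
  "greedy l M \<longleftrightarrow> (\<forall>(b, y)\<in>#M. l b < y) \<and>
     (\<forall>(a, x)\<in>#M. \<forall>(b, y)\<in>#M. a < b \<and> l b < x \<longrightarrow> y \<le> x)"

lemma greedy_mono: "greedy l M \<Longrightarrow> set_mset N \<subseteq> set_mset M \<Longrightarrow> greedy l N"
  unfolding greedy_def by (auto simp: subset_iff; blast)

text \<open>The pair named here depends only on the two projections of \<open>M\<close>. So two
  greedy multisets with equal projections share an element, which \<open>greedy_unique\<close>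
  removes.\<close>

lemma greedy_top:
  assumes "greedy l M" "M \<noteq> {#}"
  defines "b \<equiv> Max (fst ` set_mset M)"
  shows "(b, Min {x \<in> snd ` set_mset M. l b < x}) \<in># M"
proof -
  define Y where "Y = {y. (b, y) \<in># M}"
  have fin: "finite Y" unfolding Y_def
    by (rule finite_subset[of _ "snd ` set_mset M"]) force+
  have "b \<in> fst ` set_mset M" unfolding b_def using assms(2) by (intro Max_in) auto
  then have "Y \<noteq> {}" unfolding Y_def by force
  then have y: "(b, Min Y) \<in># M" using Min_in[OF fin] by (simp add: Y_def)
  have "Min {x \<in> snd ` set_mset M. l b < x} = Min Y"
  proof (rule Min_eqI)
    show "Min Y \<in> {x \<in> snd ` set_mset M. l b < x}"
      using y assms(1) unfolding greedy_def by force
    fix x assume "x \<in> {x \<in> snd ` set_mset M. l b < x}"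
    then obtain a where a: "(a, x) \<in># M" "l b < x" by auto
    have "a \<le> b" unfolding b_def using a(1) by (intro Max_ge) force+
    show "Min Y \<le> x"
    proof (cases "a = b")
      case True
      then show ?thesis using a fin by (simp add: Y_def)
    next
      case False
      then show ?thesis using \<open>a \<le> b\<close> assms(1) a y unfolding greedy_def by fastforce
    qed
  qed simp
  then show ?thesis using y by simp
qed

lemma greedy_unique:
  assumes "greedy l M" "greedy l M'" "image_mset fst M = image_mset fst M'" "image_mset snd M = image_mset snd M'"
  shows "M = M'"
  using assms
proof (induction "size M" arbitrary: M M')
  case 0
  then show ?case by simp
next
  case (Suc n)
  have ne: "M \<noteq> {#}" "M' \<noteq> {#}" using Suc.hyps(2) Suc.prems(3) by auto
  have sets: "fst ` set_mset M = fst ` set_mset M'" "snd ` set_mset M = snd ` set_mset M'"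
    using Suc.prems(3,4) by (metis set_image_mset)+
  obtain z where z: "z \<in># M" "z \<in># M'"
    using greedy_top[OF Suc.prems(1) ne(1)] greedy_top[OF Suc.prems(2) ne(2)] sets by metis
  have "M - {#z#} = M' - {#z#}"
  proof (rule Suc.hyps(1))
    show "n = size (M - {#z#})" using Suc.hyps(2) z by (simp add: size_Diff_singleton)
    show "greedy l (M - {#z#})" "greedy l (M' - {#z#})"
      using Suc.prems(1,2) by (auto intro: greedy_mono dest: in_diffD)
    show "image_mset fst (M - {#z#}) = image_mset fst (M' - {#z#})"
      "image_mset snd (M - {#z#}) = image_mset snd (M' - {#z#})"
      using Suc.prems(3,4) z by (simp_all add: image_mset_Diff)
  qed
  then show ?case using z by (metis insert_DiffM)
qed

text \<open>Reversed, so that the lexicographic order on lists looks at the last rows first and the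
  head is the last entry: whether a new row creates a crossing depends on the last row in which two
  columns differ.\<close>

definition prefix :: "nat \<Rightarrow> (nat \<Rightarrow> nat) \<Rightarrow> nat list" where
  "prefix s f = rev (map f [0..<Suc s])"

lemma prefix_Suc: "prefix (Suc s) f = f (Suc s) # prefix s f"
  by (simp add: prefix_def)

lemma prefix_less:
  "prefix s f < prefix s g \<Longrightarrow> \<exists>p\<le>s. f p < g p \<and> (\<forall>t. p < t \<and> t \<le> s \<longrightarrow> f t = g t)"
proof (induction s)
  case 0
  then show ?case by (simp add: prefix_def)
next
  case (Suc s)
  consider "f (Suc s) < g (Suc s)" | "f (Suc s) = g (Suc s)" "prefix s f < prefix s g"
    using Suc.prems by (auto simp: prefix_Suc)
  then show ?case
  proof cases
    case 1
    then show ?thesis by (intro exI[of _ "Suc s"]) simp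
  next
    case 2
    then obtain p where "p \<le> s" "f p < g p" "\<forall>t. p < t \<and> t \<le> s \<longrightarrow> f t = g t" using Suc.IH by blast
    then show ?thesis using 2 by (intro exI[of _ p]) (auto simp: le_Suc_eq)
  qed
qed

text \<open>Let \<open>p\<close> be the last row up to \<open>s\<close> in which two columns differ.
  If the column that is larger at \<open>p\<close> passed over an admissible smaller value, rows
  \<open>p\<close> and \<open>Suc s\<close> would form a crossing.\<close>

lemma greedy_prefixes:
  assumes "\<And>f. f \<in># F \<Longrightarrow> strict_mono f" and "\<And>f g. f \<in># F \<Longrightarrow> g \<in># F \<Longrightarrow> \<not> cross f g"
  shows "greedy hd (image_mset (\<lambda>f. (prefix s f, f (Suc s))) F)"
proof -
  have hd: "hd (prefix s f) = f s" for f by (simp add: prefix_def)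
  have "g (Suc s) \<le> f (Suc s)" if f: "f \<in># F" and g: "g \<in># F" and less: "prefix s f < prefix s g" and gf: "g s < f (Suc s)" for f g
  proof (rule ccontr)
    assume *: "\<not> g (Suc s) \<le> f (Suc s)"
    obtain p where p: "p \<le> s" "f p < g p" "\<forall>t. p < t \<and> t \<le> s \<longrightarrow> f t = g t"
      using prefix_less[OF less] by blast
    have "g p \<le> g s" using assms(1)[OF g] p(1) by (simp add: strict_mono_less_eq)
    then have "cross f g"
      unfolding cross_def using p * gf by (intro exI[of _ p] exI[of _ "Suc s"]) auto
    then show False using assms(2) f g by blast
  qed
  moreover have "f s < f (Suc s)" if "f \<in># F" for f using assms(1)[OF that] by (simp add: strict_mono_less)
  ultimately show ?thesis unfolding greedy_def by (auto simp: hd)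
qed

text \<open>The columns are rebuilt row by row: the columns cut off after row \<open>s\<close> and
  the values in the next row admit only one greedy matching.\<close>

lemma noncrossing_unique:
  assumes T: "\<And>I. I \<in># T \<Longrightarrow> I \<subseteq> {1..m}" and T': "\<And>I. I \<in># T' \<Longrightarrow> I \<subseteq> {1..m}"
    and nc: "\<And>I J. I \<in># T \<Longrightarrow> J \<in># T \<Longrightarrow> \<not> cross (entry m I) (entry m J)"
    and nc': "\<And>I J. I \<in># T' \<Longrightarrow> J \<in># T' \<Longrightarrow> \<not> cross (entry m I) (entry m J)"
    and rows: "same_rows m T T'"
  shows "T = T'"
proof -
  define F F' where "F = image_mset (entry m) T" and "F' = image_mset (entry m) T'"
  have sm: "strict_mono f" if "f \<in># F \<or> f \<in># F'" for f
    using that T T' column_seq_entry unfolding F_def F'_def column_seq_def by fastforce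
  have ncF: "\<not> cross f g" if "f \<in># F" "g \<in># F" for f g using that nc by (auto simp: F_def)
  have ncF': "\<not> cross f g" if "f \<in># F'" "g \<in># F'" for f g using that nc' by (auto simp: F'_def)
  have r: "image_mset (\<lambda>f. f s) F = image_mset (\<lambda>f. f s) F'" for s
    using rows by (simp add: same_rows_def F_def F'_def multiset.map_comp comp_def)
  have pre: "image_mset (prefix s) F = image_mset (prefix s) F'" for s
  proof (induction s)
    case 0
    have "image_mset (\<lambda>x. [x]) (image_mset (\<lambda>f. f 0) F) = image_mset (\<lambda>x. [x]) (image_mset (\<lambda>f. f 0) F')"
      using r by simp
    then show ?case by (simp add: multiset.map_comp comp_def prefix_def)
  next
    case (Suc s)
    have "image_mset (\<lambda>f. (prefix s f, f (Suc s))) F = image_mset (\<lambda>f. (prefix s f, f (Suc s))) F'"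
    proof (rule greedy_unique)
      show "greedy hd (image_mset (\<lambda>f. (prefix s f, f (Suc s))) F)" using sm ncF by (intro greedy_prefixes) auto
      show "greedy hd (image_mset (\<lambda>f. (prefix s f, f (Suc s))) F')" using sm ncF' by (intro greedy_prefixes) auto
    qed (use Suc r in \<open>simp_all add: multiset.map_comp comp_def\<close>)
    from arg_cong[OF this, of "image_mset (\<lambda>(a, x). x # a)"]
    show ?case by (simp add: multiset.map_comp comp_def prefix_Suc)
  qed
  \<comment> \<open>A subset of \<open>{1..m}\<close> has at most \<open>m\<close> elements, so its
    first \<open>m + 1\<close> entries contain all of them, and the bound \<open>m\<close> strips
    the padding.\<close>
  define G where "G = (\<lambda>xs. {x \<in> set xs. x \<le> m})"
  have G: "G (prefix m (entry m I)) = I" if "I \<subseteq> {1..m}" for I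
  proof -
    have "finite I" "card I \<le> m" using that finite_subset card_mono[OF _ that] by auto
    then have "I = entry m I ` {..<card I}" by (simp add: entry_image)
    also have "\<dots> = {x \<in> entry m I ` {0..<Suc m}. x \<le> m}"
      using entry_le_iff[OF that] \<open>card I \<le> m\<close> by auto
    also have "\<dots> = G (prefix m (entry m I))"
      unfolding G_def prefix_def set_rev set_map set_upt ..
    finally show ?thesis ..
  qed
  have "image_mset G (image_mset (prefix m) F) = T"
    unfolding F_def multiset.map_comp comp_def using G T by (intro multiset.map_ident_strong) auto
  moreover have "image_mset G (image_mset (prefix m) F') = T'"
    unfolding F'_def multiset.map_comp comp_def using G T' by (intro multiset.map_ident_strong) auto
  ultimately show ?thesis using pre by simp
qed

text \<open>These are the semistandard tableaux. The padding exceeds all genuine entries, so a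
  column that is smaller in this order is at least as long, and rows weakly increase from the least
  column to the greatest.\<close>

definition chain :: "nat \<Rightarrow> nat set multiset \<Rightarrow> bool" where
  "chain m T \<longleftrightarrow> (\<forall>I\<in>#T. \<forall>J\<in>#T. entry m I \<le> entry m J \<or> entry m J \<le> entry m I)"

lemma chain_least:
  assumes "chain m T" "T \<noteq> {#}"
  obtains I where "I \<in># T" "\<And>J. J \<in># T \<Longrightarrow> entry m I \<le> entry m J"
proof -
  obtain f where f: "f \<in> entry m ` set_mset T" "\<And>g. g \<in> entry m ` set_mset T \<Longrightarrow> g \<le> f \<Longrightarrow> f = g"
    using finite_has_minimal[of "entry m ` set_mset T"] assms(2) by auto
  then obtain I where I: "I \<in># T" "f = entry m I" by auto
  have "entry m I \<le> entry m J" if "J \<in># T" for J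
    using assms(1) f(2)[of "entry m J"] I that unfolding chain_def by fastforce
  then show thesis using that I by blast
qed

text \<open>The least column of a chain consists of the minima of the rows, so the rows determine it
  and it can be split off.\<close>

lemma chain_unique:
  assumes "\<And>I. I \<in># T \<Longrightarrow> I \<subseteq> {1..m}" "\<And>I. I \<in># T' \<Longrightarrow> I \<subseteq> {1..m}" 
    and "chain m T" "chain m T'" "same_rows m T T'"
  shows "T = T'"
  using assms
proof (induction "size T" arbitrary: T T')
  case 0
  then show ?case by (simp add: same_rows_def)
next
  case (Suc n)
  have rows: "(\<lambda>I. entry m I s) ` set_mset T = (\<lambda>I. entry m I s) ` set_mset T'" for s
    using Suc.prems(5) unfolding same_rows_def by (metis set_image_mset)
  have ne: "T \<noteq> {#}" "T' \<noteq> {#}" using Suc.hyps(2) rows[of 0] by auto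
  obtain I where I: "I \<in># T" "\<And>J. J \<in># T \<Longrightarrow> entry m I \<le> entry m J"
    using chain_least Suc.prems(3) ne(1) by blast
  obtain I' where I': "I' \<in># T'" "\<And>J. J \<in># T' \<Longrightarrow> entry m I' \<le> entry m J"
    using chain_least Suc.prems(4) ne(2) by blast
  have "entry m I s = entry m I' s" for s
  proof (rule antisym)
    have "entry m I' s \<in> (\<lambda>I. entry m I s) ` set_mset T" using rows I' by blast
    then show "entry m I s \<le> entry m I' s" using I(2) by (auto simp: le_fun_def)
    have "entry m I s \<in> (\<lambda>I. entry m I s) ` set_mset T'" using rows I by blast
    then show "entry m I' s \<le> entry m I s" using I'(2) by (auto simp: le_fun_def)
  qed
  then have "entry m I = entry m I'" by auto
  then have eq: "I = I'" using inj_onD[OF inj_on_entry, of m I I'] Suc.prems(1,2) I I' by auto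
  have "T - {#I#} = T' - {#I#}"
  proof (rule Suc.hyps(1))
    show "n = size (T - {#I#})" using Suc.hyps(2) I by (simp add: size_Diff_singleton)
    show "chain m (T - {#I#})" "chain m (T' - {#I#})"
      using Suc.prems(3,4) unfolding chain_def by (meson in_diffD)+
    show "same_rows m (T - {#I#}) (T' - {#I#})"
      using Suc.prems(5) I I' eq by (simp add: same_rows_def image_mset_Diff)
  qed (use Suc.prems in_diffD in \<open>metis\<close>)+
  then show ?case using I I' eq by (metis insert_DiffM)
qed

section \<open>Straightening\<close>

lemma const_simps:
  "const 0 = 0" "const 1 = 1" "const (a + b) = const a + const b" "const (a * b) = const a * const b"
  "const (- a) = - const a" "const (of_nat n) = of_nat n"
proof -
  show *: "const 0 = 0" "const 1 = 1" "const (a + b) = const a + const b" for a b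
    by (simp_all add: const_def single_add)
  show "const (a * b) = const a * const b" by (simp add: const_def mult_single)
  show "const (- a) = - const a" by (simp add: const_def single_uminus)
  show "const (of_nat n) = of_nat n" by (induction n) (simp_all add: *)
qed

interpretation cpoly: vector_space "\<lambda>c p. const c * (p :: ('v::type) cpoly)"
  by unfold_locales (simp_all add: const_simps algebra_simps)

lemma span_mult_right:
  assumes "p \<in> cpoly.span B" shows "p * q \<in> cpoly.span ((\<lambda>b. b * q) ` B)"
  using assms
proof (induction rule: cpoly.span_induct_alt)
  case base
  then show ?case by (simp add: cpoly.span_zero)
next
  case (step c x y)
  have "(const c * x + y) * q = const c * (x * q) + y * q" by (simp add: algebra_simps)
  then show ?case using step by (simp add: cpoly.span_add cpoly.span_scale cpoly.span_base)
qed

text \<open>The columns are given by a sequence instead of a set, because Garnir's relations permute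
  entries between two minors and produce unsorted and repeated columns. Repetition gives 0, disorder
  a sign.\<close>

definition colminor :: "nat \<Rightarrow> (nat \<Rightarrow> nat) \<Rightarrow> (nat \<times> nat) cpoly" where
  "colminor k w = det (mat k k (\<lambda>(r, c). var (Suc r, w c)))"

lemma colminor_cong:
  assumes "\<And>i. i < k \<Longrightarrow> w i = w' i" shows "colminor k w = colminor k w'"
  unfolding colminor_def by (rule arg_cong[where f = det], rule cong_mat) (use assms in auto)

lemma minor_eq_colminor: "minor I = colminor (card I) (entry m I)"
  unfolding minor_def by (subst colminor_def, rule arg_cong[where f = det], rule cong_mat) (auto simp: entry_def)

lemma colminor_col:
  "colminor k w = (\<Sum>p | p permutes {0..<k}. signof p * (\<Prod>j<k. var (Suc (p j), w j)))"
proof -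
  have "(\<Prod>j<k. mat k k (\<lambda>(r, c). var (Suc r, w c)) $$ (p j, j)) = (\<Prod>j<k. var (Suc (p j), w j))"
    if "p permutes {0..<k}" for p
    by (rule prod.cong) (use that permutes_in_image[OF that] in auto)
  then show ?thesis unfolding colminor_def by (subst det_col[of _ k]) auto
qed

lemma colminor_transpose: "colminor k w = det (mat k k (\<lambda>(i, j). var (Suc j, w i)))"
proof -
  have "transpose_mat (mat k k (\<lambda>(r, c). var (Suc r, w c))) = mat k k (\<lambda>(i, j). var (Suc j, w i))"
    by (rule eq_matI) auto
  then show ?thesis
    unfolding colminor_def by (metis det_transpose mat_carrier)
qed

lemma colminor_permute:
  assumes "p permutes {0..<k}" shows "colminor k (w \<circ> p) = signof p * colminor k w"
proof -
  have "mat k k (\<lambda>(i, j). var (Suc j, (w \<circ> p) i)) =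
      mat k k (\<lambda>(i, j). mat k k (\<lambda>(i, j). var (Suc j, w i)) $$ (p i, j))"
    using permutes_in_image[OF assms] by (intro eq_matI) auto
  then show ?thesis unfolding colminor_transpose
    using det_permute_rows[OF mat_carrier assms, of "\<lambda>(i, j). var (Suc j, w i)"] by simp
qed

lemma colminor_not_inj:
  assumes "\<not> inj_on w {..<k}" shows "colminor k w = 0"
proof -
  obtain i j where "i < k" "j < k" "i \<noteq> j" "w i = w j" using assms by (auto simp: inj_on_def)
  then show ?thesis unfolding colminor_transpose
    by (intro det_identical_rows[of _ k i j]) (auto intro!: eq_vecI)
qed

lemma signof_const: "\<exists>c. signof p = const c"
  by (cases p rule: sign_cases) (auto intro: exI[of _ 1] exI[of _ "-1"] simp: const_simps)

lemma colminor_inj: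
  assumes "inj_on w {..<k}" shows "\<exists>c. colminor k w = const c * minor (w ` {..<k})"
proof -
  define I where "I = w ` {..<k}"
  define h where "h = (\<lambda>i. sorted_list_of_set I ! i)"
  have I: "finite I" "card I = k" using assms by (simp_all add: I_def card_image)
  then have h: "bij_betw h {..<k} I"
    unfolding h_def using bij_betw_nth[of "sorted_list_of_set I" "{..<k}" I] by simp
  have w: "bij_betw w {..<k} I" using assms by (simp add: I_def bij_betw_def)
  \<comment> \<open>\<open>p\<close> sends a position to the rank of its entry in \<open>I\<close>,
    so it is the permutation that sorts \<open>w\<close>; its sign is the constant sought.\<close>
  define p where "p = (\<lambda>i. if i < k then inv_into {..<k} h (w i) else i)"
  have "bij_betw p {..<k} {..<k}"
    using bij_betw_trans[OF w bij_betw_inv_into[OF h]]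
    by (rule bij_betw_cong[THEN iffD1, rotated]) (simp add: p_def)
  then have p: "p permutes {0..<k}"
    by (intro bij_imp_permutes) (auto simp: p_def atLeast0LessThan)
  have "h (p i) = w i" if "i < k" for i
    using that h w by (simp add: p_def bij_betw_inv_into_right[OF h] bij_betw_apply[OF w])
  then have "colminor k w = colminor k (h \<circ> p)" by (intro colminor_cong) simp
  also have "\<dots> = signof p * colminor k h" by (rule colminor_permute[OF p])
  also have "colminor k h = minor I" by (simp add: minor_def colminor_def I h_def)
  finally show ?thesis using signof_const[of p] unfolding I_def by metis
qed

lemma double_eq_zero:
  assumes "(S :: 'v cpoly) = - S" shows "S = 0"
proof -
  have "S = const (1 / 2) * (S + S)"
    using cpoly.scale_left_distrib[of "1 / 2" "1 / 2" S] by (simp add: distrib_left const_simps mult_ac)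
  also have "S + S = 0" using assms by (metis add.right_inverse)
  finally show ?thesis by simp
qed

text \<open>Composition with the transposition of \<open>a\<close> and \<open>b\<close> changes the
  sign of \<open>p\<close> but, both positions being in the same row, only reorders the factors. The
  sum equals its own negative, which over the complex numbers forces 0.\<close>

lemma alternating_sum_zero:
  fixes X :: "nat \<Rightarrow> nat \<Rightarrow> 'v cpoly"
  assumes "finite N" "A \<subseteq> N" "a \<in> A" "b \<in> A" "a \<noteq> b" "row_of a = row_of b"
  shows "(\<Sum>p | p permutes A. signof p * (\<Prod>q\<in>N. X (row_of q) (w (p q)))) = 0" (is "?S = 0")
proof (rule double_eq_zero)
  define t where "t = Transposition.transpose a b"
  have tA: "t permutes A" and tN: "t permutes N"
    using assms by (auto simp: t_def intro: permutes_swap_id)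
  have tt: "t \<circ> t = id" by (simp add: t_def)
  have perm: "permutation p" if "p permutes A" for p
    using that assms(1,2) finite_subset permutes_imp_permutation by metis
  have "?S = (\<Sum>p | p permutes A. signof (p \<circ> t) * (\<Prod>q\<in>N. X (row_of q) (w ((p \<circ> t) q))))"
    by (rule sum.reindex_bij_witness[where i = "\<lambda>p. p \<circ> t" and j = "\<lambda>p. p \<circ> t"])
       (auto simp: comp_assoc tt intro: permutes_compose[OF tA])
  also have "\<dots> = (\<Sum>p | p permutes A. - (signof p * (\<Prod>q\<in>N. X (row_of q) (w (p q)))))"
  proof (rule sum.cong[OF refl])
    fix p assume "p \<in> {p. p permutes A}"
    then have s: "sign (p \<circ> t) = - sign p"
      using sign_compose[OF perm perm[OF tA], of p] assms(5) by (simp add: t_def sign_swap_id)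
    have "row_of (t q) = row_of q" for q using assms(6) by (auto simp: t_def Transposition.transpose_def)
    then have "(\<Prod>q\<in>N. X (row_of q) (w ((p \<circ> t) q))) = (\<Prod>q\<in>N. X (row_of q) (w (p q)))"
      using prod.permute[OF tN, of "\<lambda>q. X (row_of q) (w (p q))"] by (simp add: comp_def)
    then show "signof (p \<circ> t) * (\<Prod>q\<in>N. X (row_of q) (w ((p \<circ> t) q))) =
        - (signof p * (\<Prod>q\<in>N. X (row_of q) (w (p q))))" using s by simp
  qed
  finally show "?S = - ?S" by (simp add: sum_negf)
qed

text \<open>The sum alternates in more than \<open>k\<close> columns, which only have entries in \<open>k\<close> rows.\<close>

lemma garnir:
  assumes "A \<subseteq> {..<k + l}" "k < card A" "l \<le> k"
  shows "(\<Sum>p | p permutes A. signof p * (colminor k (w \<circ> p) * colminor l (\<lambda>i. w (p (k + i))))) = 0"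
proof -
  define X where "X = (\<lambda>r c. var (Suc r, c) :: (nat \<times> nat) cpoly)"
  define P where "P = (\<lambda>n. {p. p permutes {0..<n::nat}})"
  define row_of where "row_of = (\<lambda>a b q. if q < k then a q else b (q - k) :: nat)"
  \<comment> \<open>Both determinants are expanded by the Leibniz formula, with the columns of the
    second numbered from \<open>k\<close> on. For row permutations \<open>a\<close> and
    \<open>b\<close>, \<open>row_of a b q\<close> is the row used at position
    \<open>q\<close>.\<close>
  have 1: "colminor k (w \<circ> p) * colminor l (\<lambda>i. w (p (k + i))) =
     (\<Sum>a\<in>P k. \<Sum>b\<in>P l. signof a * signof b * (\<Prod>q<k + l. X (row_of a b q) (w (p q))))" for p
  proof -
    have "colminor k (w \<circ> p) * colminor l (\<lambda>i. w (p (k + i))) = (\<Sum>a\<in>P k. \<Sum>b\<in>P l.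
      (signof a * (\<Prod>j<k. X (a j) (w (p j)))) * (signof b * (\<Prod>j<l. X (b j) (w (p (k + j))))))"
      unfolding colminor_col sum_product P_def X_def by simp
    moreover have "(\<Prod>q<k + l. X (row_of a b q) (w (p q))) =
       (\<Prod>j<k. X (a j) (w (p j))) * (\<Prod>j<l. X (b j) (w (p (k + j))))" for a b
    proof -
      have split: "(\<Prod>q<k + l. F q) = (\<Prod>q<k. F q) * (\<Prod>q<l. F (k + q))" for F :: "nat \<Rightarrow> (nat \<times> nat) cpoly"
        by (induction l) (simp_all add: mult.assoc)
      show ?thesis unfolding split by (intro arg_cong2[where f = "(*)"] prod.cong) (auto simp: row_of_def)
    qed
    ultimately show ?thesis by (simp add: mult_ac)
  qed
  have 2: "(\<Sum>p | p permutes A. signof p * (\<Prod>q<k + l. X (row_of a b q) (w (p q)))) = 0"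
    if ab: "a \<in> P k" "b \<in> P l" for a b
  proof -
    have "row_of a b ` A \<subseteq> {..<k}"
    proof
      fix y assume "y \<in> row_of a b ` A"
      then obtain q where q: "q < k + l" "y = row_of a b q" using assms(1) by auto
      have "a q < k" if "q < k" using that ab(1) permutes_in_image[of a "{0..<k}" q] by (simp add: P_def)
      moreover have "b (q - k) < l" if "\<not> q < k"
        using that q(1) ab(2) permutes_in_image[of b "{0..<l}" "q - k"] by (auto simp: P_def)
      ultimately show "y \<in> {..<k}" using q(2) assms(3) by (auto simp: row_of_def)
    qed
    then have "\<not> inj_on (row_of a b) A" using assms(2) card_inj_on_le[of "row_of a b" A "{..<k}"] by auto
    then obtain i j where "i \<in> A" "j \<in> A" "i \<noteq> j" "row_of a b i = row_of a b j" by (auto simp: inj_on_def)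
    then show ?thesis using assms(1) by (intro alternating_sum_zero[of _ _ i j]) auto
  qed
  have "(\<Sum>p | p permutes A. signof p * (colminor k (w \<circ> p) * colminor l (\<lambda>i. w (p (k + i))))) =
    (\<Sum>p | p permutes A. \<Sum>a\<in>P k. \<Sum>b\<in>P l. signof a * signof b *
       (signof p * (\<Prod>q<k + l. X (row_of a b q) (w (p q)))))"
    unfolding 1 by (simp add: sum_distrib_left mult_ac)
  also have "\<dots> = (\<Sum>a\<in>P k. \<Sum>b\<in>P l. \<Sum>p | p permutes A. signof a * signof b *
       (signof p * (\<Prod>q<k + l. X (row_of a b q) (w (p q)))))"
    by (subst sum.swap, rule sum.cong[OF refl], rule sum.swap)
  also have "\<dots> = 0"
    using 2 by (simp add: sum.neutral flip: sum_distrib_left)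
  finally show ?thesis .
qed

text \<open>The positions that enter the image of \<open>A\<close> from outside lie in
  \<open>B\<close> and are paired with the equally many positions of \<open>A\<close> that are lost;
  every pair lowers the weight.\<close>

lemma sum_permuted_block_less:
  fixes w :: "nat \<Rightarrow> nat"
  assumes fin: "finite A" "finite B" and p: "p permutes A \<union> B" and ne: "p ` A \<noteq> A"
    and less: "\<And>x y. x \<in> A \<Longrightarrow> y \<in> B \<Longrightarrow> w y < w x"
  shows "(\<Sum>i\<in>A. w (p i)) < (\<Sum>i\<in>A. w i)"
proof -
  define C where "C = p ` A"
  have inj: "inj_on p A" using permutes_inj_on[OF p] .
  have C: "C \<subseteq> A \<union> B" using permutes_image[OF p] by (auto simp: C_def)
  have card: "card C = card A" unfolding C_def using inj by (rule card_image)
  have fC: "finite C" using fin by (simp add: C_def)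
  have "card (C - A) = card (A - C)"
    using card card_Diff_subset_Int[of C A] card_Diff_subset_Int[of A C] fin fC by (simp add: Int_commute)
  then obtain h where h: "bij_betw h (C - A) (A - C)"
    using finite_same_card_bij fin fC by (meson finite_Diff)
  have "C - A \<noteq> {}" using card_subset_eq[OF fin(1), of C] card ne by (auto simp: C_def)
  then have "(\<Sum>i\<in>C - A. w i) < (\<Sum>i\<in>C - A. w (h i))"
    using C less bij_betw_apply[OF h] fC by (intro sum_strict_mono) auto
  also have "\<dots> = (\<Sum>i\<in>A - C. w i)" using h by (rule sum.reindex_bij_betw)
  finally have "(\<Sum>i\<in>C \<inter> A. w i) + (\<Sum>i\<in>C - A. w i) < (\<Sum>i\<in>A \<inter> C. w i) + (\<Sum>i\<in>A - C. w i)"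
    by (simp add: Int_commute)
  then have "sum w C < sum w A" using sum.Int_Diff[OF fC, of w A] sum.Int_Diff[OF fin(1), of w C] by simp
  then show ?thesis using sum.reindex[OF inj, of w] by (simp add: C_def)
qed

text \<open>Such a \<open>p\<close> preserves \<open>B\<close> as well, so it splits into one
  permutation inside each minor, and the two signs this produces cancel against the sign of
  \<open>p\<close>. In \<open>exchange\<close> these permutations yield copies of the original
  product.\<close>

lemma colminor_block:
  assumes p: "p permutes A \<union> B" and A: "A \<subseteq> {..<k}" and B: "B \<subseteq> {k..<k + l}" and pA: "p ` A = A"
  shows "signof p * (colminor k (w \<circ> p) * colminor l (\<lambda>i. w (p (k + i)))) =
    colminor k w * colminor l (\<lambda>i. w (k + i))"
proof -
  have fin: "finite A" "finite B" using A B finite_subset by blast+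
  have dis: "A \<inter> B = {}" using A B by fastforce
  have inj: "inj p" using permutes_inj[OF p] .
  have im: "p ` (A \<union> B) = A \<union> B" using permutes_image[OF p] .
  have B_eq: "B = (A \<union> B) - A" using dis by blast
  have "p ` ((A \<union> B) - A) = (A \<union> B) - A" unfolding image_set_diff[OF inj] im pA ..
  then have pB: "p ` B = B" using B_eq by simp
  define q1 where "q1 = (\<lambda>i. if i < k then p i else i)"
  define q2 where "q2 = (\<lambda>i. if i < k then i else p i)"
  have out: "p i = i" if "i \<notin> A" "i \<notin> B" for i using p that by (simp add: permutes_not_in)
  have ltA: "i < k" if "i \<in> A" for i using that A by auto
  have geB: "\<not> i < k" if "i \<in> B" for i using that B by fastforce
  have q1: "q1 permutes A"
  proof (rule bij_imp_permutes)
    have "q1 ` A = p ` A" using ltA by (intro image_cong) (auto simp: q1_def)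
    then show "bij_betw q1 A A"
      unfolding bij_betw_def using pA inj ltA by (auto simp: inj_on_def q1_def dest: injD)
    show "q1 i = i" if "i \<notin> A" for i using that out geB by (auto simp: q1_def)
  qed
  have q2: "q2 permutes B"
  proof (rule bij_imp_permutes)
    have "q2 ` B = p ` B" using geB by (intro image_cong) (auto simp: q2_def)
    then show "bij_betw q2 B B"
      unfolding bij_betw_def using pB inj geB by (auto simp: inj_on_def q2_def dest: injD)
    show "q2 i = i" if "i \<notin> B" for i using that out ltA by (auto simp: q2_def)
  qed
  have "p i = (q1 \<circ> q2) i" for i
  proof (cases "i < k")
    case False
    then have "\<not> p i < k" using out pB geB ltA by (metis imageI)
    then show ?thesis using False by (simp add: q1_def q2_def)
  qed (simp add: q1_def q2_def)
  then have "p = q1 \<circ> q2" by auto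
  then have sgn: "sign p = sign q1 * sign q2"
    using sign_compose permutes_imp_permutation q1 q2 fin by metis
  have "colminor k (w \<circ> p) = colminor k (w \<circ> q1)"
    by (rule colminor_cong) (simp add: q1_def)
  then have 1: "colminor k (w \<circ> p) = signof q1 * colminor k w"
    using colminor_permute[of q1 k w] permutes_subset[OF q1, of "{0..<k}"] A by (simp add: atLeast0LessThan)
  define r where "r = (\<lambda>i. q2 (k + i) - k)"
  have kl: "q2 permutes {k..<k + l}" using q2 B by (rule permutes_subset)
  have kr: "k + r i = q2 (k + i)" for i
  proof -
    have "k \<le> q2 (k + i)" using permutes_in_image[OF kl, of "k + i"] permutes_not_in[OF kl, of "k + i"]
      by (cases "k + i \<in> {k..<k + l}") auto
    then show ?thesis by (simp add: r_def)
  qed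
  have r: "r permutes {0..<l}"
  proof (rule bij_imp_permutes)
    show "r i = i" if "i \<notin> {0..<l}" for i
      using permutes_not_in[OF kl, of "k + i"] that by (simp add: r_def)
    have "r ` {0..<l} \<subseteq> {0..<l}"
    proof
      fix y assume "y \<in> r ` {0..<l}"
      then obtain i where "i < l" "y = r i" by auto
      then show "y \<in> {0..<l}" using permutes_in_image[OF kl, of "k + i"] kr[of i] by auto
    qed
    moreover have "inj_on r {0..<l}"
    proof (rule inj_onI)
      fix i j assume "r i = r j"
      then have "q2 (k + i) = q2 (k + j)" using kr by metis
      then show "i = j" using permutes_inj[OF kl] by (simp add: inj_eq)
    qed
    ultimately show "bij_betw r {0..<l} {0..<l}"
      by (simp add: bij_betw_def endo_inj_surj)
  qed
  have ij: "inj_on ((+) k) {0..<l}" by simp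
  have img: "(+) k ` {0..<l} = {k..<k + l}" by (simp add: image_add_atLeastLessThan add.commute)
  have "map_permutation {0..<l} ((+) k) r i = q2 i" for i
  proof (cases "i \<in> {k..<k + l}")
    case True
    then obtain j where "j \<in> {0..<l}" "i = k + j" using img by blast
    then show ?thesis using map_permutation_apply[OF ij, of j r] kr by simp
  next
    case False
    then show ?thesis using permutes_not_in[OF kl False] img
      by (auto simp: map_permutation_def restrict_id_def)
  qed
  then have "map_permutation {0..<l} ((+) k) r = q2" by auto
  then have sr: "sign q2 = sign r" using sign_map_permutation[OF ij r] by simp
  have "colminor l (\<lambda>i. w (p (k + i))) = colminor l ((\<lambda>i. w (k + i)) \<circ> r)"
    by (rule colminor_cong) (simp add: kr, simp add: q2_def)
  then have 2: "colminor l (\<lambda>i. w (p (k + i))) = signof r * colminor l (\<lambda>i. w (k + i))"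
    using colminor_permute[OF r] by simp
  have "signof p * (signof q1 * signof r) = (1 :: (nat \<times> nat) cpoly)"
    unfolding sgn sr by (cases q1 rule: sign_cases; cases r rule: sign_cases) simp_all
  then show ?thesis unfolding 1 2 by (simp add: mult_ac)
qed

text \<open>Garnir's relation at a row \<open>s\<close> where \<open>I\<close> has the larger entry:
  the entries of \<open>I\<close> from row \<open>s\<close> on and those of \<open>J\<close> up to
  row \<open>s\<close> are alternated. All of the former exceed all of the latter, so a permutation
  that mixes the blocks lowers the sum of the first column.\<close>

lemma exchange:
  assumes I: "I \<subseteq> {1..m}" and J: "J \<subseteq> {1..m}" and le: "card J \<le> card I"
    and ne: "\<not> entry m I \<le> entry m J"
  shows "minor I * minor J \<in> cpoly.span {minor I' * minor J' |I' J'. I' \<subseteq> {1..m} \<and> J' \<subseteq> {1..m} \<and>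
    card I' = card I \<and> card J' = card J \<and> \<Sum>I' < \<Sum>I \<and> \<Sum>I' + \<Sum>J' = \<Sum>I + \<Sum>J}" (is "_ \<in> cpoly.span ?B")
proof -
  define k l f g where "k = card I" and "l = card J" and "f = entry m I" and "g = entry m J"
  have fin: "finite I" "finite J" using I J finite_subset by blast+
  have smf: "strict_mono f" and smg: "strict_mono g"
    using column_seq_entry I J by (auto simp: f_def g_def column_seq_def)
  obtain s where s: "g s < f s" using ne by (auto simp: le_fun_def f_def g_def not_le)
  \<comment> \<open>At a padded position of \<open>J\<close> the entry \<open>m + 1 + s\<close> is
    the largest possible, so it cannot lie below that of \<open>I\<close>.\<close>
  have sl: "s < l"
  proof (rule ccontr)
    assume "\<not> s < l"
    then have "g s = m + 1 + s" by (simp add: g_def l_def entry_pad)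
    moreover have "f s \<le> m + 1 + s" using column_seq_entry[OF I] unfolding column_seq_def f_def
      by (metis le_add1 add.assoc order_refl order_trans)
    ultimately show False using s by simp
  qed
  have lk: "l \<le> k" using le by (simp add: l_def k_def)
  define w where "w = (\<lambda>q. if q < k then f q else g (q - k))"
  \<comment> \<open>The blocks have \<open>k - s\<close> and \<open>s + 1\<close> positions,
    together \<open>k + 1\<close>, one more than there are rows.\<close>
  define A B where "A = {s..<k}" and "B = {k..<k + s + 1}"
  have AB: "A \<union> B = {s..<k + s + 1}" using sl lk by (auto simp: A_def B_def)
  have sub: "A \<union> B \<subseteq> {..<k + l}" using sl lk by (auto simp: AB)
  have If: "I = f ` {..<k}" and Jg: "J = g ` {..<l}"
    using entry_image fin by (simp_all add: f_def g_def k_def l_def)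
  have wm: "w q \<in> {1..m}" if "q < k + l" for q
  proof (cases "q < k")
    case True
    then have "w q \<in> I" by (simp add: w_def If)
    then show ?thesis using I by blast
  next
    case False
    then have "w q \<in> J" using that by (auto simp: w_def Jg)
    then show ?thesis using J by blast
  qed
  have mI: "minor I = colminor k w" unfolding minor_eq_colminor[of I m] k_def[symmetric] f_def[symmetric]
    by (rule colminor_cong) (simp add: w_def)
  have mJ: "minor J = colminor l (\<lambda>i. w (k + i))" unfolding minor_eq_colminor[of J m] l_def[symmetric] g_def[symmetric]
    by (rule colminor_cong) (simp add: w_def)
  have sI: "\<Sum>I = (\<Sum>i<k. w i)"
    unfolding If by (subst sum.reindex) (use smf in \<open>auto simp: w_def strict_mono_imp_inj_on inj_on_subset\<close>)
  have sJ: "\<Sum>J = (\<Sum>i<l. w (k + i))"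
    unfolding Jg by (subst sum.reindex) (use smg in \<open>auto simp: w_def strict_mono_imp_inj_on inj_on_subset\<close>)
  have split: "(\<Sum>q<k + l. F q) = (\<Sum>q<k. F q) + (\<Sum>q<l. F (k + q))" for F :: "nat \<Rightarrow> nat"
    by (induction l) simp_all
  define F where "F = (\<lambda>p. signof p * (colminor k (w \<circ> p) * colminor l (\<lambda>i. w (p (k + i)))))"
  define P G where "P = {p. p permutes A \<union> B}" and "G = {p \<in> P. p ` A = A}"
  have finP: "finite P" unfolding P_def by (rule finite_permutations) (simp add: AB)
  \<comment> \<open>The identity keeps the blocks, so the product occurs with the nonzero
    coefficient \<open>card G\<close>, which can be divided out over the complex numbers.\<close>
  have "id \<in> G" by (simp add: G_def P_def permutes_id)
  then have G0: "card G \<noteq> 0" using finP by (auto simp: G_def)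
  have other: "F p \<in> cpoly.span ?B" if p: "p \<in> P - G" for p
  proof (cases "inj_on (w \<circ> p) {..<k} \<and> inj_on (\<lambda>i. w (p (k + i))) {..<l}")
    case False
    then have "F p = 0" using colminor_not_inj by (auto simp: F_def)
    then show ?thesis by (simp add: cpoly.span_zero)
  next
    case True
    define I' J' where "I' = (w \<circ> p) ` {..<k}" and "J' = (\<lambda>i. w (p (k + i))) ` {..<l}"
    have p1: "p permutes A \<union> B" and pA: "p ` A \<noteq> A" using p by (auto simp: P_def G_def)
    have p2: "p permutes {..<k + l}" using p1 sub by (rule permutes_subset)
    have pl: "p q < k + l" if "q < k + l" for q using permutes_in_image[OF p2, of q] that by simp
    have "I' \<subseteq> {1..m}" "J' \<subseteq> {1..m}"
      unfolding I'_def J'_def using wm pl by (auto simp del: atLeastAtMost_iff)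
    moreover have "card I' = card I" "card J' = card J"
      using True[THEN conjunct1, THEN card_image] True[THEN conjunct2, THEN card_image]
      by (simp_all add: I'_def J'_def k_def l_def)
    moreover have sI': "\<Sum>I' = (\<Sum>i<k. w (p i))" and sJ': "\<Sum>J' = (\<Sum>i<l. w (p (k + i)))"
      using sum.reindex[OF True[THEN conjunct1], of "\<lambda>x. x"] sum.reindex[OF True[THEN conjunct2], of "\<lambda>x. x"]
      by (simp_all add: I'_def J'_def)
    moreover have "\<Sum>I' + \<Sum>J' = \<Sum>I + \<Sum>J"
      unfolding sI' sJ' sI sJ using sum.permute[OF p2, of w] split[of w] split[of "\<lambda>q. w (p q)"]
      by (simp add: comp_def)
    moreover have "\<Sum>I' < \<Sum>I"
    proof -
      have "w y < w x" if "x \<in> A" "y \<in> B" for x y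
      proof -
        have "w y = g (y - k)" "y - k \<le> s" using that(2) by (auto simp: B_def w_def)
        then have "w y \<le> g s" using smg by (simp add: strict_mono_less_eq)
        moreover have "w x = f x" "s \<le> x" using that(1) by (auto simp: A_def w_def)
        then have "f s \<le> w x" using smf by (simp add: strict_mono_less_eq)
        ultimately show ?thesis using s by simp
      qed
      then have "(\<Sum>i\<in>A. w (p i)) < (\<Sum>i\<in>A. w i)"
        using p1 pA by (intro sum_permuted_block_less[of A B]) (auto simp: A_def B_def)
      moreover have "(\<Sum>i<s. w (p i)) = (\<Sum>i<s. w i)"
        using permutes_not_in[OF p1] by (intro sum.cong) (auto simp: AB)
      moreover have "{..<k} = {..<s} \<union> A" "{..<s} \<inter> A = {}" using sl lk by (auto simp: A_def)
      ultimately show ?thesis unfolding sI' sI by (simp add: sum.union_disjoint A_def)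
    qed
    ultimately have B: "minor I' * minor J' \<in> ?B" by blast
    obtain c where c: "colminor k (w \<circ> p) = const c * minor I'" using colminor_inj True I'_def by blast
    obtain d where d: "colminor l (\<lambda>i. w (p (k + i))) = const d * minor J'" using colminor_inj True J'_def by blast
    obtain e where e: "(signof p :: (nat \<times> nat) cpoly) = const e" using signof_const by blast
    have "F p = const (e * c * d) * (minor I' * minor J')"
      unfolding F_def c d e const_simps(4) by (simp only: mult_ac)
    then show ?thesis using B by (simp add: cpoly.span_base cpoly.span_scale)
  qed
  have "F p = minor I * minor J" if "p \<in> G" for p
    unfolding F_def mI mJ by (rule colminor_block[of p A B]) (use that sl in \<open>auto simp: G_def P_def A_def B_def\<close>)
  then have SG: "sum F G = of_nat (card G) * (minor I * minor J)" by simp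
  have "sum F P = 0" unfolding P_def F_def
    by (rule garnir) (use sub sl lk in \<open>auto simp: AB\<close>)
  then have "sum F (P - G) + of_nat (card G) * (minor I * minor J) = 0"
    using sum.subset_diff[of G P F] finP unfolding SG by (simp add: G_def)
  then have eq: "of_nat (card G) * (minor I * minor J) = - sum F (P - G)"
    by (simp add: eq_neg_iff_add_eq_0 add.commute)
  have "minor I * minor J = const (1 / of_nat (card G)) * (of_nat (card G) * (minor I * minor J))"
    unfolding mult.assoc[symmetric] const_simps(6)[symmetric] const_simps(4)[symmetric]
    using G0 by (simp add: const_simps)
  also have "\<dots> \<in> cpoly.span ?B"
    unfolding eq using other by (intro cpoly.span_scale cpoly.span_neg cpoly.span_sum) auto
  finally show ?thesis .
qed

section \<open>Reduction of products of minors to products along chains\<close>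

definition minors :: "nat set multiset \<Rightarrow> (nat \<times> nat) cpoly" where
  "minors T = (\<Prod>I\<in>#T. minor I)"

lemma sum_squares_spread_less:
  fixes a b :: nat
  assumes "a \<le> b" "a' < a" "a' + b' = a + b" shows "a\<^sup>2 + b\<^sup>2 < a'\<^sup>2 + b'\<^sup>2"
proof -
  obtain d where d: "a = a' + Suc d" using assms(2) less_iff_Suc_add by auto
  then have "b' = b + Suc d" using assms(3) by simp
  moreover obtain e where "b = a + e" using assms(1) le_iff_add by blast
  ultimately show ?thesis using d by (simp add: power2_eq_square algebra_simps)
qed

text \<open>Each exchange makes the weights of the two columns involved more unequal. The large weight
  on the complementary size makes a longer column lighter than any shorter one.\<close>

lemma straightening:
  assumes "set_mset T \<subseteq> Pow {1..m}"
  shows "minors T \<in> cpoly.span {minors U |U. set_mset U \<subseteq> Pow {1..m} \<and> chain m U \<and>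
    image_mset card U = image_mset card T}"
proof -
  \<comment> \<open>Column sums are at most \<open>m * m\<close>, so one unit of \<open>C\<close>
    outweighs any difference between them. \<open>B\<close> bounds every \<open>v I\<close>; since
    the size of the multiset is kept, the distance of the sum of squares from its bound serves as
    induction measure.\<close>
  define C B where "C = m * m + 1" and "B = m * m + C * m"
  define v where "v = (\<lambda>I::nat set. \<Sum>I + C * (m - card I))"
  have sum_le: "\<Sum>I \<le> m * m" if "I \<subseteq> {1..m}" for I
  proof -
    have "i \<le> m" if "i \<in> I" for i using that \<open>I \<subseteq> {1..m}\<close> by auto
    then have "\<Sum>I \<le> card I * m" using sum_bounded_above[of I "\<lambda>i. i" m] by simp
    also have "\<dots> \<le> m * m" using card_mono[OF _ that] by simp
    finally show ?thesis .
  qed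
  have vB: "(v I)\<^sup>2 \<le> B\<^sup>2" if "I \<subseteq> {1..m}" for I
    using sum_le[OF that] by (intro power_mono) (auto simp: v_def B_def intro!: add_mono)
  have bound: "(\<Sum>I\<in>#T. (v I)\<^sup>2) \<le> size T * B\<^sup>2" if "set_mset T \<subseteq> Pow {1..m}" for T
    using that by (induction T) (auto intro!: add_mono vB)
  show ?thesis using assms
  proof (induction "size T * B\<^sup>2 - (\<Sum>I\<in>#T. (v I)\<^sup>2)" arbitrary: T rule: less_induct)
    case less
    show ?case
    proof (cases "chain m T")
      case True
      then show ?thesis using less.prems by (intro cpoly.span_base) blast
    next
      case False
      have heavy: "card J \<le> card I" if "v I \<le> v J" "I \<subseteq> {1..m}" "J \<subseteq> {1..m}" for I J
      proof (rule ccontr)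
        assume "\<not> card J \<le> card I"
        moreover have "card J \<le> m" using card_mono[OF _ that(3)] by simp
        ultimately have "m - card I \<ge> Suc (m - card J)" by simp
        then have "C * Suc (m - card J) \<le> C * (m - card I)" by (rule mult_le_mono2)
        then show False using that(1) sum_le[OF that(3)] by (simp add: v_def C_def)
      qed
      \<comment> \<open>The columns are incomparable in both directions, so the lighter one may be
        called \<open>I\<close>. Then \<open>I\<close> is at least as long as \<open>J\<close>, as
        \<open>exchange\<close> requires, and lowering its weight moves the two weights
        apart.\<close>
      obtain I J where IJ: "I \<in># T" "J \<in># T" "\<not> entry m I \<le> entry m J" "v I \<le> v J" "I \<noteq> J"
      proof -
        obtain I J where "I \<in># T" "J \<in># T" "\<not> entry m I \<le> entry m J" "\<not> entry m J \<le> entry m I"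
          using False by (auto simp: chain_def)
        then show thesis using that[of I J] that[of J I] by (cases "v I \<le> v J") auto
      qed
      obtain R1 where R1: "T = add_mset I R1" using IJ(1) multi_member_split by metis
      then obtain R where "R1 = add_mset J R" using IJ(2,5) multi_member_split by (metis insert_noteq_member)
      then have T: "T = add_mset I (add_mset J R)" by (simp add: R1)
      have sub: "I \<subseteq> {1..m}" "J \<subseteq> {1..m}" "set_mset R \<subseteq> Pow {1..m}" using less.prems by (simp_all add: T)
      have 1: "minor I * minor J * minors R \<in> cpoly.span ((\<lambda>b. b * minors R) `
         {minor I' * minor J' |I' J'. I' \<subseteq> {1..m} \<and> J' \<subseteq> {1..m} \<and>
    card I' = card I \<and> card J' = card J \<and> \<Sum>I' < \<Sum>I \<and> \<Sum>I' + \<Sum>J' = \<Sum>I + \<Sum>J})"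
        using sub heavy[OF IJ(4)] IJ(3) by (intro span_mult_right exchange) auto
      have 2: "minors T = minor I * minor J * minors R" by (simp add: T minors_def mult_ac)
      have 3: "(\<lambda>b. b * minors R) ` {minor I' * minor J' |I' J'. I' \<subseteq> {1..m} \<and> J' \<subseteq> {1..m} \<and>
          card I' = card I \<and> card J' = card J \<and> \<Sum>I' < \<Sum>I \<and> \<Sum>I' + \<Sum>J' = \<Sum>I + \<Sum>J} \<subseteq>
        cpoly.span {minors U |U. set_mset U \<subseteq> Pow {1..m} \<and> chain m U \<and> image_mset card U = image_mset card T}"
        (is "_ \<subseteq> ?S")
      proof
        fix x assume "x \<in> (\<lambda>b. b * minors R) ` {minor I' * minor J' |I' J'. I' \<subseteq> {1..m} \<and> J' \<subseteq> {1..m} \<and>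
          card I' = card I \<and> card J' = card J \<and> \<Sum>I' < \<Sum>I \<and> \<Sum>I' + \<Sum>J' = \<Sum>I + \<Sum>J}"
        then obtain I' J' where IJ': "I' \<subseteq> {1..m}" "J' \<subseteq> {1..m}" "card I' = card I" "card J' = card J"
          "\<Sum>I' < \<Sum>I" "\<Sum>I' + \<Sum>J' = \<Sum>I + \<Sum>J" and x: "x = minor I' * minor J' * minors R" by blast
        define T' where "T' = add_mset I' (add_mset J' R)"
        have T'm: "set_mset T' \<subseteq> Pow {1..m}" using IJ' sub by (simp add: T'_def)
        \<comment> \<open>Sizes are kept, so \<open>v\<close> changes by the column sum alone: it
          falls on the first column and its total over both is unchanged.\<close>
        have "(v I)\<^sup>2 + (v J)\<^sup>2 < (v I')\<^sup>2 + (v J')\<^sup>2"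
          using IJ(4) by (rule sum_squares_spread_less) (use IJ' in \<open>simp_all add: v_def\<close>)
        then have "(\<Sum>I\<in>#T. (v I)\<^sup>2) < (\<Sum>I\<in>#T'. (v I)\<^sup>2)" by (simp add: T T'_def)
        moreover have "size T' = size T" by (simp add: T T'_def)
        ultimately have "size T' * B\<^sup>2 - (\<Sum>I\<in>#T'. (v I)\<^sup>2) < size T * B\<^sup>2 - (\<Sum>I\<in>#T. (v I)\<^sup>2)"
          using bound[OF T'm] by simp
        from less.hyps[OF this T'm] have "minors T' \<in> cpoly.span {minors U |U. set_mset U \<subseteq> Pow {1..m} \<and>
          chain m U \<and> image_mset card U = image_mset card T'}" .
        moreover have "image_mset card T' = image_mset card T" by (simp add: T T'_def IJ')
        moreover have "x = minors T'" by (simp add: x T'_def minors_def mult_ac)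
        ultimately show "x \<in> ?S" by simp
      qed
      show ?thesis
        unfolding 2 by (rule subsetD[OF cpoly.span_minimal[OF 3 cpoly.subspace_span] 1])
    qed
  qed
qed

section \<open>Leading monomials of minors\<close>

definition monic_at :: "'t::linorder \<Rightarrow> ('t \<Rightarrow>\<^sub>0 complex) \<Rightarrow> bool" where
  "monic_at t p \<longleftrightarrow> Poly_Mapping.lookup p t = 1 \<and> (\<forall>u\<in>Poly_Mapping.keys p. u \<le> t)"

lemma monic_atE:
  assumes "monic_at t p"
  obtains q where "p = Poly_Mapping.single t 1 + q" "\<And>u. u \<in> Poly_Mapping.keys q \<Longrightarrow> u < t"
proof
  let ?q = "p - Poly_Mapping.single t 1"
  show "p = Poly_Mapping.single t 1 + ?q" by simp
  fix u assume "u \<in> Poly_Mapping.keys ?q"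
  then have u: "Poly_Mapping.lookup p u - Poly_Mapping.lookup (Poly_Mapping.single t (1::complex)) u \<noteq> 0"
    by (simp add: lookup_minus flip: lookup_not_eq_zero_eq_in_keys)
  then have "u \<noteq> t" using assms by (auto simp: monic_at_def)
  moreover from this have "u \<in> Poly_Mapping.keys p" using u by (simp add: lookup_single in_keys_iff)
  ultimately show "u < t" using assms by (auto simp: monic_at_def less_le)
qed

lemma monic_atI:
  assumes "p = Poly_Mapping.single t 1 + q" "\<And>u. u \<in> Poly_Mapping.keys q \<Longrightarrow> u < t"
  shows "monic_at t p"
proof -
  have "Poly_Mapping.lookup q t = 0" using assms(2)[of t] by (auto simp: in_keys_iff)
  moreover have "u \<le> t" if "u \<in> Poly_Mapping.keys p" for u
    using that assms Poly_Mapping.keys_add[of "Poly_Mapping.single t 1" q] by (force simp: less_le)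
  ultimately show ?thesis unfolding monic_at_def using assms(1) by (simp add: lookup_add)
qed

lemma keys_mult_less:
  fixes p q :: "('t::{linorder, ordered_cancel_comm_monoid_add}) \<Rightarrow>\<^sub>0 complex"
  assumes "\<And>u. u \<in> Poly_Mapping.keys p \<Longrightarrow> u \<le> s" "\<And>u. u \<in> Poly_Mapping.keys q \<Longrightarrow> u < t"
    and "u \<in> Poly_Mapping.keys (p * q)"
  shows "u < s + t"
proof -
  obtain a b where "a \<in> Poly_Mapping.keys p" "b \<in> Poly_Mapping.keys q" "u = a + b"
    using Poly_Mapping.keys_mult[of p q] assms(3) by blast
  then show ?thesis using assms(1,2) by (simp add: add_le_less_mono)
qed

lemma monic_at_mult:
  fixes p q :: "('t::{linorder, ordered_cancel_comm_monoid_add}) \<Rightarrow>\<^sub>0 complex"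
  assumes "monic_at s p" "monic_at t q" shows "monic_at (s + t) (p * q)"
proof -
  obtain p' where p: "p = Poly_Mapping.single s 1 + p'" "\<And>u. u \<in> Poly_Mapping.keys p' \<Longrightarrow> u < s"
    using monic_atE[OF assms(1)] by blast
  obtain q' where q: "q = Poly_Mapping.single t 1 + q'" "\<And>u. u \<in> Poly_Mapping.keys q' \<Longrightarrow> u < t"
    using monic_atE[OF assms(2)] by blast
  show ?thesis
  proof (rule monic_atI)
    have "p * q = Poly_Mapping.single s 1 * Poly_Mapping.single t 1 + (Poly_Mapping.single t 1 * p' + p * q')"
      unfolding q(1) by (subst (1) p(1)) (simp add: algebra_simps, simp add: p(1) algebra_simps)
    then show "p * q = Poly_Mapping.single (s + t) 1 + (Poly_Mapping.single t 1 * p' + p * q')"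
      by (simp add: mult_single)
    fix u assume "u \<in> Poly_Mapping.keys (Poly_Mapping.single t 1 * p' + p * q')"
    then consider "u \<in> Poly_Mapping.keys (Poly_Mapping.single t 1 * p')" | "u \<in> Poly_Mapping.keys (p * q')"
      using Poly_Mapping.keys_add[of "Poly_Mapping.single t 1 * p'" "p * q'"] by blast
    then show "u < s + t"
    proof cases
      case 1
      then have "u < t + s" using p(2) by (intro keys_mult_less[of "Poly_Mapping.single t 1" t p' s]) auto
      then show ?thesis by (simp add: add.commute)
    next
      case 2
      then show ?thesis using q(2) assms(1) by (intro keys_mult_less[of p s q' t]) (auto simp: monic_at_def)
    qed
  qed
qed

section \<open>Diagonal terms of minors\<close>

definition transversal :: "nat \<Rightarrow> (nat \<Rightarrow> nat) \<Rightarrow> (nat \<Rightarrow> nat) \<Rightarrow> (nat \<times> nat) monom" where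
  "transversal k p w = (\<Sum>j<k. Poly_Mapping.single (Suc (p j), w j) 1)"

lemma lookup_transversal:
  "Poly_Mapping.lookup (transversal k p w) (r, c) = card {j. j < k \<and> Suc (p j) = r \<and> w j = c}"
proof -
  have "Poly_Mapping.lookup (transversal k p w) (r, c) = (\<Sum>j<k. if Suc (p j) = r \<and> w j = c then 1 else 0)"
    unfolding transversal_def lookup_sum by (rule sum.cong) (auto simp: lookup_single when_def)
  also have "\<dots> = card ({..<k} \<inter> {j. Suc (p j) = r \<and> w j = c})"
    by (simp add: sum.If_cases)
  also have "{..<k} \<inter> {j. Suc (p j) = r \<and> w j = c} = {j. j < k \<and> Suc (p j) = r \<and> w j = c}" by auto
  finally show ?thesis .
qed

lemma poly_mapping_lessI:
  assumes "Poly_Mapping.lookup s x < Poly_Mapping.lookup t x" "\<And>y. y < x \<Longrightarrow> Poly_Mapping.lookup s y = Poly_Mapping.lookup t y" shows "s < t"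
  using assms unfolding less_poly_mapping.rep_eq less_fun_def by blast

text \<open>The diagonal wins at the first row \<open>j\<close> not fixed by \<open>p\<close>: the other transversal avoids
  position \<open>(j, w j)\<close> and takes its entry of row \<open>j\<close> further to the right.\<close>

lemma transversal_less:
  assumes w: "strict_mono w" and p: "p permutes {0..<k}" and ne: "p \<noteq> id"
  shows "transversal k p w < transversal k id w"
proof -
  have "\<exists>j. p j \<noteq> j" using ne by (auto simp: fun_eq_iff)
  define j where "j = (LEAST j. p j \<noteq> j)"
  have pj: "p j \<noteq> j" unfolding j_def using \<open>\<exists>j. p j \<noteq> j\<close> by (rule LeastI_ex)
  have lt: "p i = i" if "i < j" for i using that not_less_Least unfolding j_def by blast
  have jk: "j < k" using pj permutes_not_in[OF p, of j] by auto
  have inj: "p x = p y \<longleftrightarrow> x = y" for x y using permutes_inj[OF p] by (simp add: inj_eq)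
  have wi: "w x = w y \<longleftrightarrow> x = y" for x y using w by (simp add: strict_mono_eq)
  show ?thesis
  proof (rule poly_mapping_lessI[where x = "(Suc j, w j)"])
    have 1: "{i. i < k \<and> Suc (id i) = Suc j \<and> w i = w j} = {j}" using jk by auto
    have 2: "{i. i < k \<and> Suc (p i) = Suc j \<and> w i = w j} = {}" using pj by (auto simp: wi)
    show "Poly_Mapping.lookup (transversal k p w) (Suc j, w j) < Poly_Mapping.lookup (transversal k id w) (Suc j, w j)"
      unfolding lookup_transversal 1 2 by simp
  next
    fix y :: "nat \<times> nat" assume y: "y < (Suc j, w j)"
    obtain r c where rc: "y = (r, c)" by (cases y)
    have "{i. i < k \<and> Suc (p i) = r \<and> w i = c} = {i. i < k \<and> Suc (id i) = r \<and> w i = c}"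
    proof (rule Collect_cong, rule conj_cong[OF refl])
      fix i assume "i < k"
      show "Suc (p i) = r \<and> w i = c \<longleftrightarrow> Suc (id i) = r \<and> w i = c"
      proof (cases "r < Suc j")
        case True
        then show ?thesis using lt[of "r - 1"] inj[of i "r - 1"] by (cases r) auto
      next
        case False
        then have r: "r = Suc j" "c < w j" using y rc by (auto simp: less_prod_def)
        have "\<not> (p i = j \<and> w i = c)"
        proof
          assume *: "p i = j \<and> w i = c"
          then have "\<not> i < j" "i \<noteq> j" using lt[of i] pj by auto
          then have "w j < w i" using w by (simp add: strict_mono_less)
          then show False using * r by simp
        qed
        moreover have "\<not> (i = j \<and> w i = c)" using r by auto
        ultimately show ?thesis using r by auto
      qed
    qed
    then show "Poly_Mapping.lookup (transversal k p w) y = Poly_Mapping.lookup (transversal k id w) y"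
      unfolding rc lookup_transversal by simp
  qed
qed

lemma prod_var: "(\<Prod>j<k. var (Suc (p j), w j)) = mono_poly (transversal k p w)"
  unfolding transversal_def
  by (induction k) (simp_all add: var_def mono_poly_def mult_single single_one)

lemma monic_colminor:
  assumes "strict_mono w" shows "monic_at (transversal k id w) (colminor k w)"
proof (rule monic_atI)
  define P where "P = {p. p permutes {0..<k}}"
  have fin: "finite P" by (simp add: P_def finite_permutations)
  define q where "q = (\<Sum>p\<in>P - {id}. signof p * mono_poly (transversal k p w))"
  have "id \<in> P" by (simp add: P_def permutes_id)
  show "colminor k w = Poly_Mapping.single (transversal k id w) 1 + q"
    unfolding colminor_col prod_var P_def[symmetric] q_def
    by (subst sum.remove[OF fin \<open>id \<in> P\<close>]) (simp add: mono_poly_def)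
  fix u assume "u \<in> Poly_Mapping.keys q"
  then have "u \<in> (\<Union>p\<in>P - {id}. Poly_Mapping.keys (signof p * mono_poly (transversal k p w) :: (nat \<times> nat) cpoly))"
    unfolding q_def using Poly_Mapping.keys_sum[of "\<lambda>p. signof p * mono_poly (transversal k p w)" "P - {id}"] by (rule subsetD[rotated])
  then obtain p where p: "p \<in> P - {id}" "u \<in> Poly_Mapping.keys (signof p * mono_poly (transversal k p w) :: (nat \<times> nat) cpoly)"
    by blast
  then have "u = transversal k p w"
    by (cases p rule: sign_cases) (simp_all add: mono_poly_def)
  then show "u < transversal k id w" using transversal_less[OF assms] p by (simp add: P_def)
qed

definition diag_monom :: "nat set \<Rightarrow> (nat \<times> nat) monom" where
  "diag_monom I = (\<Sum>s<card I. Poly_Mapping.single (Suc s, sorted_list_of_set I ! s) 1)"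

lemma diag_monom_eq: "diag_monom I = transversal (card I) id (entry m I)"
  unfolding diag_monom_def transversal_def by (rule sum.cong) (auto simp: entry_def)

lemma monic_minor: "I \<subseteq> {1..m} \<Longrightarrow> monic_at (diag_monom I) (minor I)"
  unfolding minor_eq_colminor[of I m] diag_monom_eq[of I m]
  by (rule monic_colminor) (use column_seq_entry in \<open>simp add: column_seq_def\<close>)

definition diag :: "nat set multiset \<Rightarrow> (nat \<times> nat) monom" where
  "diag T = (\<Sum>I\<in>#T. diag_monom I)"

lemma monic_minors: "set_mset T \<subseteq> Pow {1..m} \<Longrightarrow> monic_at (diag T) (minors T)"
proof (induction T)
  case empty
  show ?case using monic_atI[of "1 :: (nat \<times> nat) cpoly" 0 0] by (simp add: minors_def diag_def)
next
  case (add I T)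
  then show ?case
    using monic_at_mult[OF monic_minor, of I m "diag T" "minors T"] by (simp add: minors_def diag_def)
qed

lemma lookup_diag_monom:
  assumes "I \<subseteq> {1..m}"
  shows "Poly_Mapping.lookup (diag_monom I) (Suc s, c) = (if c \<le> m \<and> entry m I s = c then 1 else 0)"
    and "Poly_Mapping.lookup (diag_monom I) (0, c) = 0"
proof -
  have "{j. j < card I \<and> Suc (id j) = Suc s \<and> entry m I j = c} = (if c \<le> m \<and> entry m I s = c then {s} else {})"
    using entry_le_iff[OF assms, of s] by auto
  then show "Poly_Mapping.lookup (diag_monom I) (Suc s, c) = (if c \<le> m \<and> entry m I s = c then 1 else 0)"
    unfolding diag_monom_eq[of I m] lookup_transversal by simp
  show "Poly_Mapping.lookup (diag_monom I) (0, c) = 0" unfolding diag_monom_eq[of I m] lookup_transversal by simp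
qed

lemma lookup_diag:
  assumes "set_mset T \<subseteq> Pow {1..m}"
  shows "Poly_Mapping.lookup (diag T) (Suc s, c) = (if c \<le> m then count (image_mset (\<lambda>I. entry m I s) T) c else 0)"
    and "Poly_Mapping.lookup (diag T) (0, c) = 0"
  using assms
proof (induction T)
  case (add I T)
  { case 1 then show ?case using add.IH lookup_diag_monom(1)[of I m s c] by (simp add: diag_def lookup_add) }
  { case 2 then show ?case using add.IH lookup_diag_monom(2)[of I m c] by (simp add: diag_def lookup_add) }
qed (simp_all add: diag_def)

text \<open>Exponents record only entries up to \<open>m\<close>. The padded entries of a row are
  counted as the number of columns minus the recorded entries; the number of columns is the degree
  in the first row, since without the empty set every column has a genuine first entry.\<close>

lemma diag_eq_iff:
  assumes T: "set_mset T \<subseteq> Pow {1..m} - {{}}" and T': "set_mset T' \<subseteq> Pow {1..m} - {{}}"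
  shows "diag T = diag T' \<longleftrightarrow> same_rows m T T'"
proof
  have sub: "set_mset T \<subseteq> Pow {1..m}" "set_mset T' \<subseteq> Pow {1..m}" using T T' by auto
  assume "same_rows m T T'"
  then have "Poly_Mapping.lookup (diag T) (r, c) = Poly_Mapping.lookup (diag T') (r, c)" for r c
    by (cases r) (simp_all add: lookup_diag[OF sub(1)] lookup_diag[OF sub(2)] same_rows_def)
  then show "diag T = diag T'" by (intro poly_mapping_eqI) auto
next
  have sub: "set_mset T \<subseteq> Pow {1..m}" "set_mset T' \<subseteq> Pow {1..m}" using T T' by auto
  assume eq: "diag T = diag T'"
  have cnt: "count (image_mset (\<lambda>I. entry m I s) T) c = count (image_mset (\<lambda>I. entry m I s) T') c" if "c \<le> m" for s c
    using eq lookup_diag(1)[OF sub(1), of s c] lookup_diag(1)[OF sub(2), of s c] that by simp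
  have low: "filter_mset (\<lambda>c. c \<le> m) (image_mset (\<lambda>I. entry m I s) T) = filter_mset (\<lambda>c. c \<le> m) (image_mset (\<lambda>I. entry m I s) T')" for s
    using cnt by (intro multiset_eqI) simp
  have high: "filter_mset (\<lambda>c. \<not> c \<le> m) (image_mset (\<lambda>I. entry m I s) U) =
      replicate_mset (size U - size (filter_mset (\<lambda>c. c \<le> m) (image_mset (\<lambda>I. entry m I s) U))) (m + 1 + s)"
    if U: "set_mset U \<subseteq> Pow {1..m}" for U s
  proof -
    have "c = m + 1 + s" if c: "c \<in># filter_mset (\<lambda>c. \<not> c \<le> m) (image_mset (\<lambda>I. entry m I s) U)" for c
    proof -
      obtain I where I: "I \<in># U" "c = entry m I s" "\<not> c \<le> m" using c by auto
      then have "column_seq m (entry m I)" using U by (intro column_seq_entry) auto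
      then show ?thesis using I unfolding column_seq_def by metis
    qed
    then have "filter_mset (\<lambda>c. \<not> c \<le> m) (image_mset (\<lambda>I. entry m I s) U) =
       replicate_mset (size (filter_mset (\<lambda>c. \<not> c \<le> m) (image_mset (\<lambda>I. entry m I s) U))) (m + 1 + s)"
      by (intro set_mset_subset_singletonD subsetI) blast
    moreover have "size U = size (filter_mset (\<lambda>c. c \<le> m) (image_mset (\<lambda>I. entry m I s) U)) +
       size (filter_mset (\<lambda>c. \<not> c \<le> m) (image_mset (\<lambda>I. entry m I s) U))"
      unfolding size_union[symmetric] multiset_partition[symmetric] by simp
    ultimately show ?thesis by simp
  qed
  have sz: "size (filter_mset (\<lambda>c. c \<le> m) (image_mset (\<lambda>I. entry m I 0) U)) = size U"
    if "set_mset U \<subseteq> Pow {1..m} - {{}}" for U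
  proof -
    have "entry m I 0 \<le> m" if "I \<in># U" for I
      using that \<open>set_mset U \<subseteq> Pow {1..m} - {{}}\<close> entry_le_iff[of I m 0] finite_subset[of I "{1..m}"]
      by (auto simp: card_gt_0_iff)
    then have "filter_mset (\<lambda>c. c \<le> m) (image_mset (\<lambda>I. entry m I 0) U) = image_mset (\<lambda>I. entry m I 0) U"
      by (simp add: filter_mset_eq_conv)
    then show ?thesis by simp
  qed
  have "size T = size T'" using sz[OF T] sz[OF T'] low[of 0] by simp
  then have "filter_mset (\<lambda>c. \<not> c \<le> m) (image_mset (\<lambda>I. entry m I s) T) =
     filter_mset (\<lambda>c. \<not> c \<le> m) (image_mset (\<lambda>I. entry m I s) T')" for s
    unfolding high[OF sub(1)] high[OF sub(2)] low by simp
  then have "image_mset (\<lambda>I. entry m I s) T = image_mset (\<lambda>I. entry m I s) T'" for s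
    using low[of s] multiset_partition[of "image_mset (\<lambda>I. entry m I s) T" "\<lambda>c. c \<le> m"]
      multiset_partition[of "image_mset (\<lambda>I. entry m I s) T'" "\<lambda>c. c \<le> m"] by (simp only:)
  then show "same_rows m T T'" by (simp add: same_rows_def)
qed

section \<open>The term order\<close>

definition monom_of :: "'a multiset \<Rightarrow> 'a monom" where
  "monom_of T = (\<Sum>I\<in>#T. Poly_Mapping.single I 1)"

definition mset_of :: "'a monom \<Rightarrow> 'a multiset" where
  "mset_of t = (\<Sum>I\<in>Poly_Mapping.keys t. replicate_mset (Poly_Mapping.lookup t I) I)"

lemma lookup_monom_of: "Poly_Mapping.lookup (monom_of T) I = count T I"
  by (induction T) (simp_all add: monom_of_def lookup_add lookup_single when_def)

lemma count_mset_of: "count (mset_of t) I = Poly_Mapping.lookup t I"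
proof -
  have "count (mset_of t) I = (\<Sum>J\<in>Poly_Mapping.keys t. if J = I then Poly_Mapping.lookup t I else 0)"
    unfolding mset_of_def count_sum by (rule sum.cong) auto
  also have "\<dots> = Poly_Mapping.lookup t I" by (simp add: in_keys_iff)
  finally show ?thesis .
qed

lemma monom_of_mset_of [simp]: "monom_of (mset_of t) = t"
  by (rule poly_mapping_eqI) (simp add: lookup_monom_of count_mset_of)

lemma mset_of_monom_of [simp]: "mset_of (monom_of T) = T"
  by (rule multiset_eqI) (simp add: lookup_monom_of count_mset_of)

lemma mset_of_add: "mset_of (s + t) = mset_of s + mset_of t"
  by (rule multiset_eqI) (simp add: count_mset_of lookup_add)

lemma mset_of_zero [simp]: "mset_of 0 = {#}"
  by (simp add: mset_of_def)

lemma set_mset_of: "set_mset (mset_of t) = Poly_Mapping.keys t"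
  by (rule Set.set_eqI) (simp add: in_keys_iff count_mset_of flip: count_greater_zero_iff)

lemma poly_mapping_nat_nonneg: "(0 :: ('a::linorder) \<Rightarrow>\<^sub>0 nat) \<le> t"
proof (cases "t = 0")
  case False
  define k where "k = Min (Poly_Mapping.keys t)"
  have "k \<in> Poly_Mapping.keys t" unfolding k_def using False by (intro Min_in) auto
  moreover have "y \<notin> Poly_Mapping.keys t" if "y < k" for y
    using that unfolding k_def by (meson Min_le finite_keys leD)
  ultimately have "0 < t" by (intro poly_mapping_lessI[of _ k]) (auto simp: in_keys_iff)
  then show ?thesis by simp
qed simp

text \<open>On exponents supported in one finite set the order becomes the lexicographic order on
  lists of a fixed length. Without such a bound, variables of ever larger index can form an infinite
  descending sequence.\<close>

lemma wf_poly_mapping_finite_support: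
  assumes "finite (A :: 'a::linorder set)"
  shows "wf {(s, t :: 'a \<Rightarrow>\<^sub>0 nat). s < t \<and> Poly_Mapping.keys s \<subseteq> A \<and> Poly_Mapping.keys t \<subseteq> A}"
proof (rule wf_subset)
  define L where "L = sorted_list_of_set A"
  show "wf (inv_image (lex less_than) (\<lambda>t :: 'a \<Rightarrow>\<^sub>0 nat. map (Poly_Mapping.lookup t) L))"
    by (intro wf_inv_image wf_lex wf_less_than)
  show "{(s, t :: 'a \<Rightarrow>\<^sub>0 nat). s < t \<and> Poly_Mapping.keys s \<subseteq> A \<and> Poly_Mapping.keys t \<subseteq> A}
    \<subseteq> inv_image (lex less_than) (\<lambda>t. map (Poly_Mapping.lookup t) L)"
  proof clarify
    fix s t :: "'a \<Rightarrow>\<^sub>0 nat"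
    assume st: "s < t" "Poly_Mapping.keys s \<subseteq> A" "Poly_Mapping.keys t \<subseteq> A"
    obtain k where k: "Poly_Mapping.lookup s k < Poly_Mapping.lookup t k"
      "\<And>y. y < k \<Longrightarrow> Poly_Mapping.lookup s y = Poly_Mapping.lookup t y"
      using st(1) unfolding less_poly_mapping.rep_eq less_fun_def by blast
    have "k \<in> A" using k(1) st(3) by (auto simp: in_keys_iff)
    then obtain xs ys where L: "L = xs @ k # ys" using assms split_list[of k L] by (auto simp: L_def)
    have "sorted_wrt (<) L" by (simp add: L_def)
    then have "\<forall>x\<in>set xs. x < k" by (simp add: L sorted_wrt_append)
    then have eq: "map (Poly_Mapping.lookup s) xs = map (Poly_Mapping.lookup t) xs" using k(2) by simp
    show "(s, t) \<in> inv_image (lex less_than) (\<lambda>t. map (Poly_Mapping.lookup t) L)"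
      unfolding in_inv_image L map_append eq by (rule lex_append_leftI) (simp add: k(1))
  qed
qed

text \<open>Monomials are compared by the diagonal terms of their images first, then by the lags, and
  finally by the variables themselves, which only makes the order antisymmetric.\<close>

definition column_key :: "nat \<Rightarrow> (nat set \<Rightarrow> nat) \<Rightarrow> nat set \<Rightarrow> (nat \<times> nat \<times> nat) monom" where
  "column_key m e I = (\<Sum>s<card I. Poly_Mapping.single (0, Suc s, sorted_list_of_set I ! s) 1) +
     (\<Sum>d<m. Poly_Mapping.single (1, d, 0) (lag m d I)) + Poly_Mapping.single (2, e I, 0) 1"

definition order_key :: "nat \<Rightarrow> (nat set \<Rightarrow> nat) \<Rightarrow> nat set multiset \<Rightarrow> (nat \<times> nat \<times> nat) monom" where
  "order_key m e T = (\<Sum>I\<in>#T. column_key m e I)"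

lemma lookup_column_key:
  "Poly_Mapping.lookup (column_key m e I) (0, a, b) = Poly_Mapping.lookup (diag_monom I) (a, b)"
  "Poly_Mapping.lookup (column_key m e I) (1, d, b) = (if d < m \<and> b = 0 then lag m d I else 0)"
  "Poly_Mapping.lookup (column_key m e I) (2, c, 0) = (if e I = c then 1 else 0)"
proof -
  show "Poly_Mapping.lookup (column_key m e I) (0, a, b) = Poly_Mapping.lookup (diag_monom I) (a, b)"
    by (simp add: column_key_def diag_monom_def lookup_add lookup_sum lookup_single when_def)
  have "(\<Sum>x<m. if x = d \<and> 0 = b then lag m x I else 0) = (\<Sum>x<m. if x = d then (if b = 0 then lag m d I else 0) else 0)"
    by (rule sum.cong) auto
  also have "\<dots> = (if d < m \<and> b = 0 then lag m d I else 0)" by simp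
  finally show "Poly_Mapping.lookup (column_key m e I) (1, d, b) = (if d < m \<and> b = 0 then lag m d I else 0)"
    by (simp add: column_key_def lookup_add lookup_sum lookup_single when_def)
  show "Poly_Mapping.lookup (column_key m e I) (2, c, 0) = (if e I = c then 1 else 0)"
    by (simp add: column_key_def lookup_add lookup_sum lookup_single when_def)
qed

lemma lookup_order_key:
  "Poly_Mapping.lookup (order_key m e T) (0, a, b) = Poly_Mapping.lookup (diag T) (a, b)"
  "Poly_Mapping.lookup (order_key m e T) (1, d, b) = (if d < m \<and> b = 0 then \<Sum>I\<in>#T. lag m d I else 0)"
  "Poly_Mapping.lookup (order_key m e T) (2, c, 0) = count (image_mset e T) c"
  by (induction T) (simp_all add: order_key_def diag_def lookup_add lookup_column_key del: One_nat_def)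

text \<open>Additivity is what the encoding is for: with all three criteria written as exponents of
  a single monomial, the comparison of keys is compatible with multiplication.\<close>

lemma order_key_add: "order_key m e (T + U) = order_key m e T + order_key m e U"
  by (simp add: order_key_def)

text \<open>The tag 0 of the diagonal block precedes the tags 1 and 2 in the order on triples, so
  the first difference of the keys is that of the diagonal terms.\<close>

lemma order_key_less_diag:
  assumes "diag T < diag U" shows "order_key m e T < order_key m e U"
proof -
  obtain k where k: "Poly_Mapping.lookup (diag T) k < Poly_Mapping.lookup (diag U) k"
      "\<And>y. y < k \<Longrightarrow> Poly_Mapping.lookup (diag T) y = Poly_Mapping.lookup (diag U) y"
    using assms unfolding less_poly_mapping.rep_eq less_fun_def by blast
  obtain a b where ab: "k = (a, b)" by (cases k)
  show ?thesis
  proof (rule poly_mapping_lessI[where x = "(0, a, b)"])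
    show "Poly_Mapping.lookup (order_key m e T) (0, a, b) < Poly_Mapping.lookup (order_key m e U) (0, a, b)"
      using k(1) by (simp add: ab lookup_order_key)
    fix y :: "nat \<times> nat \<times> nat" assume y: "y < (0, a, b)"
    obtain p a' b' where y': "y = (p, a', b')" by (cases y)
    then have "p = 0" "(a', b') < (a, b)" using y by (auto simp: less_prod_def)
    then show "Poly_Mapping.lookup (order_key m e T) y = Poly_Mapping.lookup (order_key m e U) y"
      using k(2) by (simp add: y' ab lookup_order_key)
  qed
qed

lemma order_key_less_lag:
  assumes "diag T = diag U" "d < m" "\<And>c. c < d \<Longrightarrow> (\<Sum>I\<in>#T. lag m c I) = (\<Sum>I\<in>#U. lag m c I)"
    and "(\<Sum>I\<in>#T. lag m d I) < (\<Sum>I\<in>#U. lag m d I)"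
  shows "order_key m e T < order_key m e U"
proof (rule poly_mapping_lessI[where x = "(1, d, 0)"])
  show "Poly_Mapping.lookup (order_key m e T) (1, d, 0) < Poly_Mapping.lookup (order_key m e U) (1, d, 0)"
    using assms by (simp only: lookup_order_key) simp
  fix y :: "nat \<times> nat \<times> nat" assume y: "y < (1, d, 0)"
  obtain p a b where y': "y = (p, a, b)" by (cases y)
  consider "p = 0" | "p = 1" "a < d" using y y' by (auto simp: less_prod_def le_Suc_eq)
  then show "Poly_Mapping.lookup (order_key m e T) y = Poly_Mapping.lookup (order_key m e U) y"
    by cases (simp_all add: y' lookup_order_key assms del: One_nat_def)
qed

definition noncross :: "nat \<Rightarrow> nat set multiset \<Rightarrow> bool" where
  "noncross m T \<longleftrightarrow> (\<forall>I\<in>#T. \<forall>J\<in>#T. \<not> cross (entry m I) (entry m J))"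

lemma keys_sum_mset_subset:
  "Poly_Mapping.keys (\<Sum>I\<in>#T. f I :: 'a monom) \<subseteq> (\<Union>I\<in>set_mset T. Poly_Mapping.keys (f I))"
proof (induction T)
  case (add x T)
  then show ?case using Poly_Mapping.keys_add[of "f x" "\<Sum>I\<in>#T. f I"] by auto
qed simp

text \<open>Closure under equal size is the trace of the staircase: tail exchanges and Garnir's
  relations only redistribute entries between columns of given sizes. The numbering \<open>e\<close>
  serves the last tie-break of the order.\<close>

locale column_family =
  fixes m :: nat and V :: "nat set set" and e :: "nat set \<Rightarrow> nat"
  assumes V_subset: "V \<subseteq> Pow {1..m} - {{}}"
    and V_card: "\<And>I J. I \<in> V \<Longrightarrow> J \<subseteq> {1..m} \<Longrightarrow> card J = card I \<Longrightarrow> J \<in> V"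
    and inj_e: "inj_on e V"
begin

abbreviation key :: "nat set multiset \<Rightarrow> (nat \<times> nat \<times> nat) monom" where
  "key \<equiv> order_key m e"

lemma finite_V: "finite V"
  using V_subset by (rule finite_subset) simp

lemma on_V: "set_mset T \<subseteq> V \<Longrightarrow> set_mset T \<subseteq> Pow {1..m}" "set_mset T \<subseteq> V \<Longrightarrow> set_mset T \<subseteq> Pow {1..m} - {{}}"
  using V_subset by auto

lemma key_inj:
  assumes "set_mset T \<subseteq> V" "set_mset U \<subseteq> V" "key T = key U" shows "T = U"
proof (rule multiset_eqI)
  fix I
  have "image_mset e T = image_mset e U"
    using assms(3) lookup_order_key(3)[of m e T] lookup_order_key(3)[of m e U]
    by (intro multiset_eqI) metis
  moreover have "image_mset (inv_into V e) (image_mset e W) = W" if "set_mset W \<subseteq> V" for W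
    unfolding multiset.map_comp using that inj_e by (intro multiset.map_ident_strong) (auto simp: subset_iff)
  ultimately show "count T I = count U I" using assms by metis
qed

lemma wf_key: "wf {(T, U). set_mset T \<subseteq> V \<and> set_mset U \<subseteq> V \<and> key T < key U}"
proof -
  define A where "A = (\<Union>I\<in>V. Poly_Mapping.keys (column_key m e I))"
  have "finite A" using finite_V by (simp add: A_def)
  from wf_inv_image[OF wf_poly_mapping_finite_support[OF this], of key] show ?thesis
  proof (rule wf_subset)
    have "Poly_Mapping.keys (key T) \<subseteq> A" if "set_mset T \<subseteq> V" for T
      using keys_sum_mset_subset[of "column_key m e" T] that by (auto simp: order_key_def A_def)
    then show "{(T, U). set_mset T \<subseteq> V \<and> set_mset U \<subseteq> V \<and> key T < key U} \<subseteq>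
       inv_image {(s, t). s < t \<and> Poly_Mapping.keys s \<subseteq> A \<and> Poly_Mapping.keys t \<subseteq> A} key" by auto
  qed
qed

lemma wf_diag: "wf {(T, U). set_mset T \<subseteq> V \<and> set_mset U \<subseteq> V \<and> diag T < diag U}"
  by (rule wf_subset[OF wf_key]) (auto intro: order_key_less_diag)

text \<open>Uncrossing terminates, since every tail exchange keeps the diagonal term and lowers a
  lag without changing those before it. With \<open>noncross_diag_unique\<close>, the non-crossing
  multiset has the least key among all with its diagonal term.\<close>

lemma lowering:
  assumes "set_mset T \<subseteq> V"
  shows "\<exists>N. set_mset N \<subseteq> V \<and> noncross m N \<and> diag N = diag T \<and> key N \<le> key T"
  using assms
proof (induction T rule: wf_induct_rule[OF wf_key])
  case (1 T)
  show ?case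
  proof (cases "noncross m T")
    case True
    then show ?thesis using 1(2) by blast
  next
    case False
    then obtain I J where IJ: "I \<in># T" "J \<in># T" and c: "cross (entry m I) (entry m J)"
      by (auto simp: noncross_def)
    then have "I \<noteq> J" by (auto simp: cross_def)
    obtain R1 where R1: "T = add_mset I R1" using IJ(1) multi_member_split by metis
    then obtain R where "R1 = add_mset J R" using IJ(2) \<open>I \<noteq> J\<close> multi_member_split by (metis insert_noteq_member)
    then have T: "T = add_mset I (add_mset J R)" by (simp add: R1)
    have sub: "I \<subseteq> {1..m}" "J \<subseteq> {1..m}" "I \<in> V" "J \<in> V" using on_V(1)[OF 1(2)] 1(2) IJ by auto
    obtain I' J' d where u: "I' \<subseteq> {1..m}" "J' \<subseteq> {1..m}" "card I' = card J" "card J' = card I"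
      "\<And>s. {#entry m I' s, entry m J' s#} = {#entry m I s, entry m J s#}"
      "d < m" "\<And>c. c < d \<Longrightarrow> lag m c I' + lag m c J' = lag m c I + lag m c J"
      "lag m d I' + lag m d J' < lag m d I + lag m d J"
      using uncross[OF sub(1,2) c] by blast
    define T' where "T' = add_mset I' (add_mset J' R)"
    have V': "I' \<in> V" "J' \<in> V" using V_card sub u by blast+
    then have T'V: "set_mset T' \<subseteq> V" using 1(2) by (simp add: T T'_def)
    have "image_mset (\<lambda>I. entry m I s) T' = image_mset (\<lambda>I. entry m I s) T" for s
    proof -
      have "image_mset (\<lambda>I. entry m I s) U = {#entry m A s, entry m B s#} + image_mset (\<lambda>I. entry m I s) R"
        if "U = add_mset A (add_mset B R)" for U A B by (simp add: that)
      then show ?thesis using T T'_def u(5)[of s] by metis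
    qed
    then have "same_rows m T' T" by (simp add: same_rows_def)
    then have dg: "diag T' = diag T" using diag_eq_iff on_V(2) T'V 1(2) by blast
    have less: "key T' < key T"
      by (rule order_key_less_lag[OF dg u(6)]) (use u(7,8) in \<open>simp_all add: T T'_def flip: add.assoc\<close>)
    then obtain N where "set_mset N \<subseteq> V" "noncross m N" "diag N = diag T'" "key N \<le> key T'"
      using 1(1)[of T'] T'V 1(2) by blast
    then show ?thesis using dg less by (intro exI[of _ N]) simp
  qed
qed

lemma noncross_diag_unique:
  assumes "set_mset N \<subseteq> V" "set_mset N' \<subseteq> V" "noncross m N" "noncross m N'" "diag N = diag N'"
  shows "N = N'"
proof (rule noncrossing_unique[of N m N'])
  show "same_rows m N N'" using assms diag_eq_iff on_V(2) by blast
  show "I \<subseteq> {1..m}" if "I \<in># N" for I using on_V(1)[OF assms(1)] that by blast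
  show "I \<subseteq> {1..m}" if "I \<in># N'" for I using on_V(1)[OF assms(2)] that by blast
qed (use assms(3,4) in \<open>auto simp: noncross_def\<close>)

end

section \<open>Standard monomials\<close>

lemma lookup_const_mult: "Poly_Mapping.lookup (const c * p) t = c * Poly_Mapping.lookup p t"
proof -
  have p: "p = (\<Sum>k\<in>Poly_Mapping.keys p. Poly_Mapping.single k (Poly_Mapping.lookup p k))"
    by (rule poly_mapping_eqI) (simp add: lookup_sum lookup_single when_def in_keys_iff)
  have "const c * p = (\<Sum>k\<in>Poly_Mapping.keys p. Poly_Mapping.single k (c * Poly_Mapping.lookup p k))"
    by (subst p) (simp add: sum_distrib_left const_def mult_single)
  then show ?thesis by (simp add: lookup_sum lookup_single when_def in_keys_iff)
qed

lemma minors_mset_of: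
  "(\<Prod>I\<in>Poly_Mapping.keys t. minor I ^ Poly_Mapping.lookup t I) = minors (mset_of t)"
  unfolding minors_def by (simp add: image_prod_mset_multiplicity set_mset_of count_mset_of)

lemma subst_minor_superset:
  assumes "finite X" "Poly_Mapping.keys p \<subseteq> X"
  shows "subst_poly minor p = (\<Sum>t\<in>X. const (Poly_Mapping.lookup p t) * minors (mset_of t))"
  unfolding subst_poly_def minors_mset_of
  by (rule sum.mono_neutral_left) (use assms in \<open>auto simp: in_keys_iff const_simps\<close>)

lemma subst_minor_add: "subst_poly minor (p + q) = subst_poly minor p + subst_poly minor q"
proof -
  define X where "X = Poly_Mapping.keys p \<union> Poly_Mapping.keys q"
  have X: "finite X" "Poly_Mapping.keys p \<subseteq> X" "Poly_Mapping.keys q \<subseteq> X" "Poly_Mapping.keys (p + q) \<subseteq> X"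
    using Poly_Mapping.keys_add[of p q] by (auto simp: X_def)
  show ?thesis
    unfolding subst_minor_superset[OF X(1,2)] subst_minor_superset[OF X(1,3)] subst_minor_superset[OF X(1,4)]
    by (simp add: lookup_add const_simps distrib_right sum.distrib)
qed

lemma subst_minor_single: "subst_poly minor (Poly_Mapping.single t c) = const c * minors (mset_of t)"
  by (subst subst_minor_superset[of "{t}"]) auto

text \<open>An expansion in the algebra becomes a polynomial in the variables with known monomials,
  from which relations can be formed.\<close>

lemma span_minors_preimage:
  assumes "p \<in> cpoly.span {minors N |N. N \<in> X}"
  shows "\<exists>q. Poly_Mapping.keys q \<subseteq> monom_of ` X \<and> subst_poly minor q = p"
  using assms
proof (induction rule: cpoly.span_induct_alt)
  case base
  then show ?case by (intro exI[of _ 0]) (simp add: subst_poly_def)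
next
  case (step c x y)
  then obtain N q where N: "N \<in> X" "x = minors N" and q: "Poly_Mapping.keys q \<subseteq> monom_of ` X" "subst_poly minor q = y"
    by blast
  then show ?case
    using Poly_Mapping.keys_add[of "Poly_Mapping.single (monom_of N) c" q]
    by (intro exI[of _ "Poly_Mapping.single (monom_of N) c + q"])
       (auto simp: subst_minor_add subst_minor_single split: if_splits)
qed

text \<open>Every product of minors is monic at its diagonal term. Where one diagonal term strictly
  dominates, none of the other products reaches it, so nothing cancels there.\<close>

lemma
  assumes V: "V \<subseteq> Pow {1..m}" and q: "Poly_Mapping.keys q \<subseteq> monomials V" and t: "t \<in> Poly_Mapping.keys q"
    and max: "\<And>s. s \<in> Poly_Mapping.keys q \<Longrightarrow> s \<noteq> t \<Longrightarrow> diag (mset_of s) < diag (mset_of t)"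
  shows lookup_subst_lead: "Poly_Mapping.lookup (subst_poly minor q) (diag (mset_of t)) = Poly_Mapping.lookup q t"
    and keys_subst_le: "u \<in> Poly_Mapping.keys (subst_poly minor q) \<Longrightarrow> u \<le> diag (mset_of t)"
proof -
  have monic: "monic_at (diag (mset_of s)) (minors (mset_of s))" if "s \<in> Poly_Mapping.keys q" for s
    by (rule monic_minors) (use that V q in \<open>auto simp: set_mset_of monomials_def subset_iff\<close>)
  have lookup: "Poly_Mapping.lookup (subst_poly minor q) u =
     (\<Sum>s\<in>Poly_Mapping.keys q. Poly_Mapping.lookup q s * Poly_Mapping.lookup (minors (mset_of s)) u)" for u
    by (simp add: subst_minor_superset[of "Poly_Mapping.keys q"] lookup_sum lookup_const_mult)
  have zero: "Poly_Mapping.lookup (minors (mset_of s)) u = 0"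
    if "s \<in> Poly_Mapping.keys q" "diag (mset_of s) < u" for s u
  proof -
    have "u \<notin> Poly_Mapping.keys (minors (mset_of s))"
      using monic[OF that(1)] that(2) unfolding monic_at_def by (meson leD)
    then show ?thesis by (simp add: in_keys_iff)
  qed
  have "Poly_Mapping.lookup (subst_poly minor q) (diag (mset_of t)) =
     (\<Sum>s\<in>Poly_Mapping.keys q. if s = t then Poly_Mapping.lookup q t else 0)"
    unfolding lookup
  proof (rule sum.cong[OF refl])
    fix s assume "s \<in> Poly_Mapping.keys q"
    then show "Poly_Mapping.lookup q s * Poly_Mapping.lookup (minors (mset_of s)) (diag (mset_of t)) =
        (if s = t then Poly_Mapping.lookup q t else 0)"
      using zero[of s] max[of s] monic[of s] by (cases "s = t") (auto simp: monic_at_def)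
  qed
  then show "Poly_Mapping.lookup (subst_poly minor q) (diag (mset_of t)) = Poly_Mapping.lookup q t"
    using t by simp
  show "u \<le> diag (mset_of t)" if u: "u \<in> Poly_Mapping.keys (subst_poly minor q)"
  proof (rule ccontr)
    assume "\<not> u \<le> diag (mset_of t)"
    then have less: "diag (mset_of t) < u" by simp
    have "Poly_Mapping.lookup (minors (mset_of s)) u = 0" if "s \<in> Poly_Mapping.keys q" for s
      using zero[OF that, of u] max[OF that] less by (cases "s = t") auto
    then have "Poly_Mapping.lookup (subst_poly minor q) u = 0" by (simp add: lookup)
    then show False using u by (simp add: in_keys_iff)
  qed
qed

lemma finite_max_point:
  assumes "finite X" "X \<noteq> {}"
  obtains t where "t \<in> X" "\<And>s. s \<in> X \<Longrightarrow> (f s :: 'b::linorder) \<le> f t"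
proof -
  have "Max (f ` X) \<in> f ` X" using assms by (intro Max_in) auto
  then obtain t where "t \<in> X" "f t = Max (f ` X)" by auto
  then show thesis using that[of t] assms(1) by simp
qed

context column_family
begin

text \<open>The diagonal terms of products of minors are all the leading monomials of the algebra, because
  products along chains span it and have pairwise different leading monomials.\<close>

lemma leading_diag:
  assumes p: "p \<in> cpoly.span {minors T |T. set_mset T \<subseteq> V}" and "p \<noteq> 0"
  shows "\<exists>U. set_mset U \<subseteq> V \<and> diag U \<in> Poly_Mapping.keys p \<and> (\<forall>u\<in>Poly_Mapping.keys p. u \<le> diag U)"
proof -
  define X where "X = {U. set_mset U \<subseteq> V \<and> chain m U}"
  have "{minors T |T. set_mset T \<subseteq> V} \<subseteq> cpoly.span {minors N |N. N \<in> X}"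
  proof clarify
    fix T assume T: "set_mset T \<subseteq> V"
    have "{minors U |U. set_mset U \<subseteq> Pow {1..m} \<and> chain m U \<and> image_mset card U = image_mset card T}
      \<subseteq> {minors N |N. N \<in> X}"
    proof clarify
      fix U assume U: "set_mset U \<subseteq> Pow {1..m}" "chain m U" "image_mset card U = image_mset card T"
      \<comment> \<open>Straightening keeps the sizes of the columns, so it does not leave a family
        closed under equal size.\<close>
      have "J \<in> V" if "J \<in># U" for J
      proof -
        have "card J \<in># image_mset card T" using that U(3) by (metis imageI set_image_mset)
        then obtain I where "I \<in># T" "card J = card I" by auto
        then show ?thesis using V_card[of I J] T U(1) that by blast
      qed
      then show "\<exists>N. minors U = minors N \<and> N \<in> X" using U(2) by (auto simp: X_def)
    qed
    then show "minors T \<in> cpoly.span {minors N |N. N \<in> X}"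
      using straightening[OF on_V(1)[OF T]] cpoly.span_mono by blast
  qed
  then have "p \<in> cpoly.span {minors N |N. N \<in> X}"
    using p cpoly.span_minimal[OF _ cpoly.subspace_span] by blast
  then obtain q where q: "Poly_Mapping.keys q \<subseteq> monom_of ` X" "subst_poly minor q = p"
    using span_minors_preimage by blast
  have qX: "mset_of s \<in> X" if "s \<in> Poly_Mapping.keys q" for s
    using that q(1) by auto
  then have qV: "Poly_Mapping.keys q \<subseteq> monomials V"
    by (auto simp: X_def monomials_def set_mset_of)
  have "q \<noteq> 0" using q(2) assms(2) by (auto simp: subst_poly_def)
  then obtain t where t: "t \<in> Poly_Mapping.keys q"
    "\<And>s. s \<in> Poly_Mapping.keys q \<Longrightarrow> diag (mset_of s) \<le> diag (mset_of t)"
    using finite_max_point[of "Poly_Mapping.keys q" "\<lambda>s. diag (mset_of s)"] by auto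
  have max: "diag (mset_of s) < diag (mset_of t)" if s: "s \<in> Poly_Mapping.keys q" "s \<noteq> t" for s
  proof -
    have "diag (mset_of s) \<noteq> diag (mset_of t)"
    proof
      assume eq: "diag (mset_of s) = diag (mset_of t)"
      have X: "mset_of s \<in> X" "mset_of t \<in> X" using qX s t by auto
      then have sub: "set_mset (mset_of s) \<subseteq> V" "set_mset (mset_of t) \<subseteq> V" by (auto simp: X_def)
      have "mset_of s = mset_of t"
      proof (rule chain_unique[of _ m])
        show "I \<subseteq> {1..m}" if "I \<in># mset_of s" for I using on_V(1)[OF sub(1)] that by blast
        show "I \<subseteq> {1..m}" if "I \<in># mset_of t" for I using on_V(1)[OF sub(2)] that by blast
        show "same_rows m (mset_of s) (mset_of t)" using diag_eq_iff on_V(2) sub eq by blast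
      qed (use X in \<open>auto simp: X_def\<close>)
      then show False using s(2) by (metis monom_of_mset_of)
    qed
    then show ?thesis using t(2)[OF s(1)] by simp
  qed
  have V: "V \<subseteq> Pow {1..m}" using V_subset by auto
  have "diag (mset_of t) \<in> Poly_Mapping.keys p"
    using lookup_subst_lead[OF V qV t(1) max] t(1) q(2) by (simp add: in_keys_iff)
  moreover have "u \<le> diag (mset_of t)" if "u \<in> Poly_Mapping.keys p" for u
    using keys_subst_le[OF V qV t(1) max] that q(2) by blast
  moreover have "set_mset (mset_of t) \<subseteq> V" using qX[OF t(1)] by (simp add: X_def)
  ultimately show ?thesis by blast
qed

text \<open>Subduction: the leading monomial of \<open>p\<close> is a diagonal term, hence that of a
  non-crossing product, a multiple of which is subtracted; descent among diagonal terms is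
  well-founded. The bound by \<open>diag U\<close> is carried along for the comparison in
  \<open>crossing_leads\<close>.\<close>

lemma noncross_spanning:
  assumes "set_mset U \<subseteq> V" "p \<in> cpoly.span {minors T |T. set_mset T \<subseteq> V}"
    and "\<And>u. u \<in> Poly_Mapping.keys p \<Longrightarrow> u \<le> diag U"
  shows "p \<in> cpoly.span {minors N |N. N \<in> {N. set_mset N \<subseteq> V \<and> noncross m N \<and> diag N \<le> diag U}}"
  using assms
proof (induction U arbitrary: p rule: wf_induct_rule[OF wf_diag])
  case (1 U)
  let ?S = "\<lambda>t. {minors N |N. N \<in> {N. set_mset N \<subseteq> V \<and> noncross m N \<and> diag N \<le> t}}"
  show ?case
  proof (cases "p = 0")
    case True
    then show ?thesis by (simp add: cpoly.span_zero)
  next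
    case False
    then obtain U' where U': "set_mset U' \<subseteq> V" "diag U' \<in> Poly_Mapping.keys p" "\<And>u. u \<in> Poly_Mapping.keys p \<Longrightarrow> u \<le> diag U'"
      using leading_diag[OF 1(3)] by blast
    obtain N where N: "set_mset N \<subseteq> V" "noncross m N" "diag N = diag U'" using lowering[OF U'(1)] by blast
    have NU: "diag N \<le> diag U" using 1(4) U'(2) N(3) by simp
    have monic: "monic_at (diag N) (minors N)" by (rule monic_minors[OF on_V(1)[OF N(1)]])
    define c where "c = Poly_Mapping.lookup p (diag N)"
    define p' where "p' = p - const c * minors N"
    have p': "p' \<in> cpoly.span {minors T |T. set_mset T \<subseteq> V}"
      unfolding p'_def by (rule cpoly.span_diff[OF 1(3) cpoly.span_scale[OF cpoly.span_base]]) (use N(1) in blast)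
    have less: "u < diag N" if "u \<in> Poly_Mapping.keys p'" for u
    proof -
      have "Poly_Mapping.lookup p u - c * Poly_Mapping.lookup (minors N) u \<noteq> 0"
        using that by (simp add: p'_def in_keys_iff lookup_minus lookup_const_mult)
      then have "u \<noteq> diag N" "u \<in> Poly_Mapping.keys p \<or> u \<in> Poly_Mapping.keys (minors N)"
        using monic by (auto simp: c_def monic_at_def in_keys_iff)
      then show ?thesis using U'(3) N(3) monic by (auto simp: monic_at_def less_le)
    qed
    have "p' \<in> cpoly.span (?S (diag U))"
    proof (cases "p' = 0")
      case True
      then show ?thesis by (simp add: cpoly.span_zero)
    next
      case False
      then obtain U'' where U'': "set_mset U'' \<subseteq> V" "diag U'' \<in> Poly_Mapping.keys p'" "\<And>u. u \<in> Poly_Mapping.keys p' \<Longrightarrow> u \<le> diag U''"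
        using leading_diag[OF p'] by blast
      have "diag U'' < diag U" using less[OF U''(2)] NU by simp
      then have "p' \<in> cpoly.span (?S (diag U''))" using 1(1)[of U'' p'] U'' p' 1(2) by blast
      moreover have "?S (diag U'') \<subseteq> ?S (diag U)" using \<open>diag U'' < diag U\<close> by auto
      ultimately show ?thesis using cpoly.span_mono by blast
    qed
    moreover have "const c * minors N \<in> cpoly.span (?S (diag U))"
      using N NU by (intro cpoly.span_scale cpoly.span_base) auto
    ultimately have "p' + const c * minors N \<in> cpoly.span (?S (diag U))" by (rule cpoly.span_add)
    moreover have "p' + const c * minors N = p" by (simp add: p'_def)
    ultimately show ?thesis by (simp only:)
  qed
qed

section \<open>The term order and its leading monomials\<close>

definition key_order :: "nat set monom rel" where
  "key_order = {(s, t). s \<in> monomials V \<and> t \<in> monomials V \<and> key (mset_of s) \<le> key (mset_of t)}"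

lemma monomials_iff: "t \<in> monomials V \<longleftrightarrow> set_mset (mset_of t) \<subseteq> V"
  by (simp add: monomials_def set_mset_of)

lemma key_order_antisym: "(s, t) \<in> key_order \<Longrightarrow> (t, s) \<in> key_order \<Longrightarrow> s = t"
  using key_inj[of "mset_of s" "mset_of t"] by (auto simp: key_order_def monomials_iff) (metis monom_of_mset_of)

lemma term_order_key_order: "term_order V key_order"
  unfolding term_order_def
proof (intro conjI ballI allI impI)
  show "linear_order_on (monomials V) key_order"
    unfolding linear_order_on_def partial_order_on_def preorder_on_def
  proof (intro conjI)
    show "refl_on (monomials V) key_order" by (auto simp: refl_on_def key_order_def)
    show "trans key_order" by (auto simp: trans_def key_order_def)
    show "antisym key_order" using key_order_antisym by (auto simp: antisym_def)
    show "total_on (monomials V) key_order" by (auto simp: total_on_def key_order_def)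
    show "key_order \<subseteq> monomials V \<times> monomials V" by (auto simp: key_order_def)
  qed
next
  fix t assume "t \<in> monomials V"
  then show "(0, t) \<in> key_order"
    by (simp add: key_order_def monomials_def order_key_def poly_mapping_nat_nonneg)
next
  fix s t u assume "(s, t) \<in> key_order \<and> u \<in> monomials V"
  then show "(s + u, t + u) \<in> key_order"
    by (auto simp: key_order_def monomials_iff mset_of_add order_key_add add_right_mono)
qed

lemma leading_monom_eqI:
  assumes "t \<in> Poly_Mapping.keys p" "\<And>s. s \<in> Poly_Mapping.keys p \<Longrightarrow> (s, t) \<in> key_order"
  shows "leading_monom key_order p = t"
  unfolding leading_monom_def using assms key_order_antisym by (intro the_equality) auto

lemma leading_monom_in:
  assumes "Poly_Mapping.keys p \<subseteq> monomials V" "p \<noteq> 0"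
  shows "leading_monom key_order p \<in> Poly_Mapping.keys p"
    and "s \<in> Poly_Mapping.keys p \<Longrightarrow> (s, leading_monom key_order p) \<in> key_order"
proof -
  obtain t where t: "t \<in> Poly_Mapping.keys p"
    "\<And>s. s \<in> Poly_Mapping.keys p \<Longrightarrow> key (mset_of s) \<le> key (mset_of t)"
    using finite_max_point[of "Poly_Mapping.keys p" "\<lambda>s. key (mset_of s)"] assms(2) by auto
  have max: "(s, t) \<in> key_order" if "s \<in> Poly_Mapping.keys p" for s
    using that t assms(1) by (auto simp: key_order_def)
  have "leading_monom key_order p = t" by (rule leading_monom_eqI[OF t(1) max])
  then show "leading_monom key_order p \<in> Poly_Mapping.keys p"
    and "s \<in> Poly_Mapping.keys p \<Longrightarrow> (s, leading_monom key_order p) \<in> key_order"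
    using t(1) max by simp_all
qed

lemma minor_relations_iff:
  "p \<in> minor_relations m V \<longleftrightarrow> Poly_Mapping.keys p \<subseteq> monomials V \<and> subst_poly minor p = 0"
  by (simp add: minor_relations_def a_kernel_def' cpoly_ring_def)

text \<open>The relation is the monomial minus its expansion in non-crossing products. Those with
  smaller diagonal term are smaller in the order; one with the same diagonal term is the result of
  uncrossing \<open>t\<close>, so its key is no larger either.\<close>

lemma crossing_leads:
  assumes t: "t \<in> monomials V" "\<not> noncross m (mset_of t)"
  shows "\<exists>p\<in>minor_relations m V. p \<noteq> 0 \<and> leading_monom key_order p = t"
proof -
  define T where "T = mset_of t"
  have TV: "set_mset T \<subseteq> V" using t(1) by (simp add: T_def monomials_iff)
  have "minors T \<in> cpoly.span {minors N |N. N \<in> {N. set_mset N \<subseteq> V \<and> noncross m N \<and> diag N \<le> diag T}}"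
    using TV monic_minors[OF on_V(1)[OF TV]]
    by (intro noncross_spanning cpoly.span_base) (auto simp: monic_at_def)
  then obtain q where q: "Poly_Mapping.keys q \<subseteq> monom_of ` {N. set_mset N \<subseteq> V \<and> noncross m N \<and> diag N \<le> diag T}"
    "subst_poly minor q = minors T" using span_minors_preimage by blast
  define p where "p = Poly_Mapping.single t 1 + (- q)"
  have "subst_poly minor (- q) + subst_poly minor q = 0"
    unfolding subst_minor_add[symmetric] by (simp add: subst_poly_def)
  then have "subst_poly minor (- q) = - minors T" using q(2) by (simp add: eq_neg_iff_add_eq_0)
  then have p0: "subst_poly minor p = 0"
    unfolding p_def subst_minor_add subst_minor_single by (simp add: const_simps T_def)
  have tq: "t \<notin> Poly_Mapping.keys q" using q(1) t(2) by auto
  have less: "(s, t) \<in> key_order" if s: "s \<in> Poly_Mapping.keys q" for s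
  proof -
    obtain N where N: "s = monom_of N" "set_mset N \<subseteq> V" "noncross m N" "diag N \<le> diag T" using q(1) s by auto
    have "key N \<le> key T"
    proof (cases "diag N = diag T")
      case True
      obtain N' where "set_mset N' \<subseteq> V" "noncross m N'" "diag N' = diag T" "key N' \<le> key T"
        using lowering[OF TV] by blast
      then show ?thesis using noncross_diag_unique N True by metis
    next
      case False
      then have "diag N < diag T" using N(4) by (simp add: less_le)
      then show ?thesis by (intro less_imp_le order_key_less_diag)
    qed
    then show ?thesis using N t(1) by (simp add: key_order_def monomials_iff T_def)
  qed
  have keysp: "s = t \<or> s \<in> Poly_Mapping.keys q" if "s \<in> Poly_Mapping.keys p" for s
    using that by (auto simp: p_def in_keys_iff lookup_add lookup_minus lookup_single when_def split: if_splits)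
  have tp: "t \<in> Poly_Mapping.keys p"
    using tq by (simp add: p_def in_keys_iff lookup_minus)
  have refl: "(t, t) \<in> key_order" using t(1) by (simp add: key_order_def)
  have le: "(s, t) \<in> key_order" if "s \<in> Poly_Mapping.keys p" for s using keysp[OF that] less refl by auto
  have "p \<in> minor_relations m V"
    unfolding minor_relations_iff using p0 le by (auto simp: key_order_def)
  moreover have "p \<noteq> 0" using tp by auto
  moreover have "leading_monom key_order p = t" by (rule leading_monom_eqI[OF tp le])
  ultimately show ?thesis by blast
qed

text \<open>A non-crossing leading monomial has the least key among the monomials with its diagonal
  term, so every other monomial of \<open>p\<close>, being smaller, has a strictly smaller diagonal
  term. Then nothing cancels the leading term in the image.\<close>

lemma leads_crossing:
  assumes p: "p \<in> minor_relations m V" "p \<noteq> 0"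
  shows "\<not> noncross m (mset_of (leading_monom key_order p))"
proof
  define t where "t = leading_monom key_order p"
  assume nc: "noncross m (mset_of (leading_monom key_order p))"
  have pV: "Poly_Mapping.keys p \<subseteq> monomials V" and p0: "subst_poly minor p = 0" using p(1) by (simp_all add: minor_relations_iff)
  have t: "t \<in> Poly_Mapping.keys p" and le: "\<And>s. s \<in> Poly_Mapping.keys p \<Longrightarrow> (s, t) \<in> key_order"
    using leading_monom_in[OF pV p(2)] by (simp_all add: t_def)
  have tV: "set_mset (mset_of t) \<subseteq> V" using t pV monomials_iff by blast
  have max: "diag (mset_of s) < diag (mset_of t)" if s: "s \<in> Poly_Mapping.keys p" "s \<noteq> t" for s
  proof -
    have sV: "set_mset (mset_of s) \<subseteq> V" using s pV monomials_iff by blast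
    have st: "key (mset_of s) \<le> key (mset_of t)" using le[OF s(1)] by (simp add: key_order_def)
    then have "\<not> diag (mset_of t) < diag (mset_of s)" using order_key_less_diag[of "mset_of t" "mset_of s" m e] by auto
    moreover have "diag (mset_of s) \<noteq> diag (mset_of t)"
    proof
      assume eq: "diag (mset_of s) = diag (mset_of t)"
      obtain N where N: "set_mset N \<subseteq> V" "noncross m N" "diag N = diag (mset_of s)" "key N \<le> key (mset_of s)"
        using lowering[OF sV] by blast
      have "N = mset_of t" using N nc tV eq by (intro noncross_diag_unique) (simp_all add: t_def)
      then have "key (mset_of s) = key (mset_of t)" using N(4) st by simp
      then have "mset_of s = mset_of t" using key_inj sV tV by blast
      then show False using s(2) by (metis monom_of_mset_of)
    qed
    ultimately show ?thesis by simp
  qed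
  have V: "V \<subseteq> Pow {1..m}" using V_subset by auto
  have "Poly_Mapping.lookup p t = 0" using lookup_subst_lead[OF V pV t max] p0 by simp
  then show False using t by (simp add: in_keys_iff)
qed

end

section \<open>Ideals spanned by monomials\<close>

lemma zero_in_monomials: "0 \<in> monomials V"
  by (simp add: monomials_def)

lemma monomials_add: "s \<in> monomials V \<Longrightarrow> t \<in> monomials V \<Longrightarrow> s + t \<in> monomials V"
  unfolding monomials_def using Poly_Mapping.keys_add[of s t] by blast

lemma keys_mult_monomials:
  assumes "Poly_Mapping.keys (p :: 'v cpoly) \<subseteq> monomials V" "Poly_Mapping.keys q \<subseteq> monomials V"
  shows "Poly_Mapping.keys (p * q) \<subseteq> monomials V"
proof
  fix u assume "u \<in> Poly_Mapping.keys (p * q)"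
  then obtain s t where "s \<in> Poly_Mapping.keys p" "t \<in> Poly_Mapping.keys q" "u = s + t"
    using Poly_Mapping.keys_mult[of p q] by blast
  then show "u \<in> monomials V" using assms by (auto intro: monomials_add)
qed

lemma keys_add_subset:
  "Poly_Mapping.keys (p :: 'v cpoly) \<subseteq> X \<Longrightarrow> Poly_Mapping.keys q \<subseteq> X \<Longrightarrow> Poly_Mapping.keys (p + q) \<subseteq> X"
  using Poly_Mapping.keys_add[of p q] by blast

lemma ring_cpoly_ring: "ring (cpoly_ring V)"
proof (rule ringI)
  show "abelian_group (cpoly_ring V)"
  proof (rule abelian_groupI)
    show "\<exists>y\<in>carrier (cpoly_ring V). y \<oplus>\<^bsub>cpoly_ring V\<^esub> x = \<zero>\<^bsub>cpoly_ring V\<^esub>"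
      if "x \<in> carrier (cpoly_ring V)" for x
      using that by (intro bexI[of _ "- x"]) (simp_all add: cpoly_ring_def)
  qed (simp_all add: cpoly_ring_def keys_add_subset add_ac)
  show "Group.monoid (cpoly_ring V)"
    by (rule monoidI) (simp_all add: cpoly_ring_def keys_mult_monomials mult_ac zero_in_monomials)
qed (simp_all add: cpoly_ring_def algebra_simps)

text \<open>Bounds the initial ideal from above. With \<open>C\<close> the crossing monomials, which
  absorb multiplication, this ideal contains the leading monomials of all relations, and the only
  monomials in it are those of \<open>C\<close>.\<close>

lemma ideal_keys_subset:
  assumes "C \<subseteq> monomials V" "\<And>s t. s \<in> C \<Longrightarrow> t \<in> monomials V \<Longrightarrow> s + t \<in> C"
  shows "ideal {p :: 'v cpoly. Poly_Mapping.keys p \<subseteq> C} (cpoly_ring V)"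
proof (rule idealI)
  interpret ring "cpoly_ring V" by (rule ring_cpoly_ring)
  show "ring (cpoly_ring V)" by (rule ring_cpoly_ring)
  show "subgroup {p. Poly_Mapping.keys p \<subseteq> C} (add_monoid (cpoly_ring V))"
  proof (rule group.subgroupI[OF a_group])
    fix p :: "'v cpoly" assume p: "p \<in> {p. Poly_Mapping.keys p \<subseteq> C}"
    have "inv\<^bsub>add_monoid (cpoly_ring V)\<^esub> p = - p"
      using p assms(1) by (intro group.inv_equality[OF a_group]) (auto simp: cpoly_ring_def)
    then show "inv\<^bsub>add_monoid (cpoly_ring V)\<^esub> p \<in> {p. Poly_Mapping.keys p \<subseteq> C}" using p by simp
  qed (use assms(1) in \<open>auto simp: cpoly_ring_def dest: keys_add_subset[THEN subsetD] intro: exI[of _ 0]\<close>)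
  fix p q :: "'v cpoly" assume p: "p \<in> {p. Poly_Mapping.keys p \<subseteq> C}" and q: "q \<in> carrier (cpoly_ring V)"
  have "Poly_Mapping.keys (p * q) \<subseteq> C"
  proof
    fix u assume "u \<in> Poly_Mapping.keys (p * q)"
    then obtain s t where "s \<in> Poly_Mapping.keys p" "t \<in> Poly_Mapping.keys q" "u = s + t"
      using Poly_Mapping.keys_mult[of p q] by blast
    then show "u \<in> C" using p q by (auto simp: cpoly_ring_def intro: assms(2))
  qed
  then show "p \<otimes>\<^bsub>cpoly_ring V\<^esub> q \<in> {p. Poly_Mapping.keys p \<subseteq> C}"
    "q \<otimes>\<^bsub>cpoly_ring V\<^esub> p \<in> {p. Poly_Mapping.keys p \<subseteq> C}" by (simp_all add: cpoly_ring_def mult.commute)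
qed

context column_family
begin

lemma mono_poly_in_initial_ideal_iff:
  assumes t: "t \<in> monomials V"
  shows "mono_poly t \<in> initial_ideal V key_order (minor_relations m V) \<longleftrightarrow> \<not> noncross m (mset_of t)"
proof
  define C where "C = {t \<in> monomials V. \<not> noncross m (mset_of t)}"
  have "ideal {p. Poly_Mapping.keys p \<subseteq> C} (cpoly_ring V)"
    by (rule ideal_keys_subset) (auto simp: C_def monomials_add mset_of_add noncross_def)
  moreover have "{mono_poly (leading_monom key_order p) |p. p \<in> minor_relations m V \<and> p \<noteq> 0}
      \<subseteq> {p. Poly_Mapping.keys p \<subseteq> C}"
  proof
    fix f assume "f \<in> {mono_poly (leading_monom key_order p) |p. p \<in> minor_relations m V \<and> p \<noteq> 0}"
    then obtain p where p: "p \<in> minor_relations m V" "p \<noteq> 0" and f: "f = mono_poly (leading_monom key_order p)" by blast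
    then have "leading_monom key_order p \<in> monomials V"
      using leading_monom_in(1)[of p] minor_relations_iff by blast
    then show "f \<in> {p. Poly_Mapping.keys p \<subseteq> C}"
      using leads_crossing[OF p] by (simp add: f mono_poly_def C_def)
  qed
  ultimately have "initial_ideal V key_order (minor_relations m V) \<subseteq> {p. Poly_Mapping.keys p \<subseteq> C}"
    unfolding initial_ideal_def using ring.genideal_minimal[OF ring_cpoly_ring] by blast
  moreover assume "mono_poly t \<in> initial_ideal V key_order (minor_relations m V)"
  ultimately show "\<not> noncross m (mset_of t)" by (auto simp: mono_poly_def C_def)
next
  assume "\<not> noncross m (mset_of t)"
  then obtain p where "p \<in> minor_relations m V" "p \<noteq> 0" "leading_monom key_order p = t"
    using crossing_leads[OF t] by blast
  then show "mono_poly t \<in> initial_ideal V key_order (minor_relations m V)"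
    unfolding initial_ideal_def genideal_def by blast
qed

lemma standard_monomials_eq:
  "standard_monomials V key_order (minor_relations m V) =
    {mono_poly t |t. t \<in> monomials V \<and> noncross m (mset_of t)}"
  unfolding standard_monomials_def using mono_poly_in_initial_ideal_iff by blast

end

lemma prod_var_eq: "(\<Prod>I\<in>#T. var I) = mono_poly (monom_of T)"
  by (induction T) (simp_all add: monom_of_def var_def mono_poly_def mult_single single_one)

text \<open>Both coordinates grow along the path, so its nodes lie weakly south-west of the
  endpoint, and a partial staircase is closed in that direction. The condition thus depends only on
  the size of \<open>I\<close>.\<close>

lemma path_nodes_subset_iff:
  assumes L: "partial_staircase m L" and I: "I \<subseteq> {1..m}"
  shows "path_nodes m I \<subseteq> L \<longleftrightarrow> (m - card I, card I) \<in> L"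
proof -
  have fin: "finite I" using I finite_subset by blast
  have m: "card ({1..m} - I) = m - card I" "{1..m} \<inter> I = I" using I fin by (auto simp: card_Diff_subset)
  show ?thesis
  proof
    have "(m - card I, card I) \<in> path_nodes m I"
      unfolding path_nodes_def using m by (intro CollectI exI[of _ m]) simp
    then show "path_nodes m I \<subseteq> L \<Longrightarrow> (m - card I, card I) \<in> L" by blast
  next
    assume "(m - card I, card I) \<in> L"
    then obtain D c d where D: "L = {(a, b). \<exists>(c, d)\<in>D. a \<le> c \<and> b \<le> d}"
      "(c, d) \<in> D" "m - card I \<le> c" "card I \<le> d"
      using L unfolding partial_staircase_def by blast
    show "path_nodes m I \<subseteq> L"
    proof
      fix z assume "z \<in> path_nodes m I"
      then obtain t where t: "t \<le> m" "z = (card ({1..t} - I), card ({1..t} \<inter> I))"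
        by (auto simp: path_nodes_def)
      have "card ({1..t} - I) \<le> m - card I" unfolding m(1)[symmetric] using t(1) by (intro card_mono) auto
      moreover have "card ({1..t} \<inter> I) \<le> card I" using fin by (intro card_mono) auto
      ultimately have "card ({1..t} - I) \<le> c" "card ({1..t} \<inter> I) \<le> d" using D(3,4) by simp_all
      then show "z \<in> L" unfolding D(1) t(2) using D(2) by blast
    qed
  qed
qed

theorem corollary8p2:
  fixes m :: nat and L :: "(nat \<times> nat) set"
  assumes "m \<ge> 1" and "partial_staircase m L"
  shows "\<exists>r. term_order (staircase_subsets m L - {{}}) r \<and>
           standard_monomials (staircase_subsets m L - {{}}) r
             (minor_relations m (staircase_subsets m L - {{}})) =
           {\<Prod>I\<in>#T. var I |T.
              set_mset T \<subseteq> staircase_subsets m L - {{}} \<and> set_mset T \<in> noncrossing_complex m L}"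
proof -
  define V where "V = staircase_subsets m L - {{}}"
  have V_iff: "I \<in> V \<longleftrightarrow> I \<subseteq> {1..m} \<and> I \<noteq> {} \<and> (m - card I, card I) \<in> L" for I
    using path_nodes_subset_iff[OF assms(2)] by (auto simp: V_def staircase_subsets_def)
  have "V \<subseteq> Pow {1..m}" using V_iff by blast
  then have "finite V" by (rule finite_subset) simp
  then obtain e :: "nat set \<Rightarrow> nat" where e: "inj_on e V" using finite_imp_inj_to_nat_seg by metis
  interpret column_family m V e
  proof
    show "V \<subseteq> Pow {1..m} - {{}}" using V_iff by blast
    show "J \<in> V" if "I \<in> V" "J \<subseteq> {1..m}" "card J = card I" for I J
    proof -
      have "I \<subseteq> {1..m}" "I \<noteq> {}" using that(1) V_iff by blast+
      then have "card I \<noteq> 0" using finite_subset by fastforce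
      then have "J \<noteq> {}" using that(3) by auto
      then show ?thesis using that by (simp add: V_iff)
    qed
  qed (rule e)
  have nc: "noncross m T \<longleftrightarrow> set_mset T \<in> noncrossing_complex m L" if T: "set_mset T \<subseteq> V" for T
  proof -
    \<comment> \<open>The complex tests only distinct columns, whereas \<open>noncross\<close> also
      pairs a column with itself, which is never a crossing.\<close>
    have irrefl: "\<not> cross f f" for f by (auto simp: cross_def)
    have sub: "I \<subseteq> {1..m}" if "I \<in># T" for I using on_V(1)[OF T] that by blast
    have "set_mset T \<subseteq> staircase_subsets m L" using T by (auto simp: V_def)
    then have "set_mset T \<in> noncrossing_complex m L \<longleftrightarrow> (\<forall>I\<in>#T. \<forall>J\<in>#T. I \<noteq> J \<longrightarrow> noncrossing I J)"
      by (simp add: noncrossing_complex_def pairwise_def)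
    also have "\<dots> \<longleftrightarrow> noncross m T"
      unfolding noncross_def
    proof (intro iffI ballI impI)
      fix I J assume a: "\<forall>I\<in>#T. \<forall>J\<in>#T. I \<noteq> J \<longrightarrow> noncrossing I J" and "I \<in># T" "J \<in># T"
      then show "\<not> cross (entry m I) (entry m J)"
        using noncrossing_iff[OF sub sub, of I J] irrefl by (cases "I = J") auto
    next
      fix I J assume "\<forall>I\<in>#T. \<forall>J\<in>#T. \<not> cross (entry m I) (entry m J)" "I \<in># T" "J \<in># T"
      then show "noncrossing I J" using noncrossing_iff[OF sub sub, of I J] by blast
    qed
    finally show ?thesis by simp
  qed
  have "standard_monomials V key_order (minor_relations m V) =
     {\<Prod>I\<in>#T. var I |T. set_mset T \<subseteq> V \<and> set_mset T \<in> noncrossing_complex m L}" (is "_ = ?R")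
  proof -
    have "{mono_poly t |t. t \<in> monomials V \<and> noncross m (mset_of t)} =
        {mono_poly (monom_of T) |T. set_mset T \<subseteq> V \<and> noncross m T}"
      unfolding monomials_iff by (intro Collect_cong) (metis monom_of_mset_of mset_of_monom_of)
    also have "\<dots> = ?R" unfolding prod_var_eq using nc by blast
    finally show ?thesis unfolding standard_monomials_eq .
  qed
  then show ?thesis
    using term_order_key_order unfolding V_def by blast
qed

end
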